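(* Let $H$ be a Hilbert space, $A=A^*$ a selfadjoint operator in $H$, and $\{\varphi_j\}_{j=1}^{\infty}$ an orthonormal basis of $H$ with $A\varphi_j=\lambda_j\varphi_j$, where $(\lambda_j)_{j\ge1}$ is a nondecreasing sequence of positive real numbers diverging to $+\infty$. Let $T>0$, $f\in C^1([0,T];H)$, $u_0\in\mathcal{D}(A)$, $u_2\in H$, and let $h\in C([0,T];\mathbf{R})$ be non-negative on $[0,T]$. With $L_j$ and $M$ as defined in the context, assume that $$\sum_{j=1}^{\infty}L_j\,\lambda_j^3\,\exp(2\lambda_jMT)<+\infty.$$ Then the problem $$u''(t)=\int_0^t h(t-s)Au(s)\,ds+f(t),\quad 0\le t\le T,\qquad u(0)=u_0,\quad u(T)=u_2,$$ has a solution in $C^2([0,T];H)\cap C([0,T];\mathcal{D}(A))$, and this solution is unique.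
   Context: $\mathcal{D}(A)$ carries the graph norm and $(\cdot,\cdot)$ is the scalar product of $H$. Write $(a*b)(t)=\int_0^t a(t-s)b(s)\,ds$. Set $\widehat u_{0,j}=(u_0,\varphi_j)$, $\widehat u_{2,j}=(u_2,\varphi_j)$, $\widehat f_j(t)=(f(t),\varphi_j)$, and $$\widetilde f_j(t)=\int_0^t(t-s)\widehat f_j(s)\,ds,\qquad h^{(1)}(t)=\int_0^t(t-s)h(s)\,ds .$$ Let $k_j\in C([0,T])$ be the resolvent kernel defined by $(I-\lambda_jV)^{-1}=I+\lambda_jK_j$, where $Vv=h^{(1)}*v$ and $K_jv=k_j*v$; equivalently $k_j=\sum_{m=1}^{\infty}\lambda_j^{m-1}h_m$ with $h_1=h^{(1)}$, $h_m=h^{(1)}*h_{m-1}$. (Since $h\ge0$ and $\lambda_j>0$, $k_j\ge 0$, so the denominator below is positive.) Set $$c_j=\frac{\widehat u_{2,j}-\widehat u_{0,j}-\widetilde f_j(T)-\lambda_j\int_0^Tk_j(T-s)\,[\widehat u_{0,j}+\widetilde f_j(s)]\,ds}{T+\lambda_j\int_0^Tk_j(T-s)\,s\,ds},$$ $$L_j=|\widehat u_{0,j}|^2+T^2|c_j|^2+\sup_{0\le t\le T}|\widetilde f_j(t)|^2,\qquad M=T\int_0^T|h(t)|\,dt .$$ *)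

theory Defs
  imports "HOL-Analysis.Analysis"
begin

section \<open>Hilbert spaces over the real or the complex numbers\<close>

text \<open>The sort \<open>{real_normed_field, euclidean_space}\<close> consists of the finite-dimensional commutative
  normed division algebras with a Euclidean norm, i.e. of (copies of) the real and the complex
  numbers, so both kinds of Hilbert spaces are treated at once. On such a field \<open>x \<bullet> 1\<close> is the real
  part of \<open>x\<close>, which gives the following uniform expression for the conjugate.\<close>

definition scalar_conj :: "'k::{real_normed_field,euclidean_space} \<Rightarrow> 'k" where
  "scalar_conj x = of_real (2 * (x \<bullet> 1)) - x"

lemma scalar_conj_real: "scalar_conj x = x" for x :: real
  by (simp add: scalar_conj_def)

lemma scalar_conj_complex: "scalar_conj z = cnj z" for z :: complex
  by (simp add: scalar_conj_def complex_eq_iff inner_complex_def)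

text \<open>The topology of the space is that of the type class; axiom \<open>ip_self\<close> says that its complete
  norm is the one induced by the scalar product. The product is linear in the first argument.\<close>

locale hilbert_space = vector_space smul
  for smul :: "'k::{real_normed_field,euclidean_space} \<Rightarrow> 'h::banach \<Rightarrow> 'h" +
  fixes ip :: "'h \<Rightarrow> 'h \<Rightarrow> 'k"
  assumes scale_of_real: "smul (of_real r) x = r *\<^sub>R x"
    and ip_add_left: "ip (x + y) z = ip x z + ip y z"
    and ip_scale_left: "ip (smul a x) y = a * ip x y"
    and ip_commute: "ip y x = scalar_conj (ip x y)"
    and ip_self: "ip x x = of_real ((norm x)\<^sup>2)"

lemma hilbert_space_real_inner:
  "hilbert_space (scaleR :: real \<Rightarrow> 'h::{real_inner,banach} \<Rightarrow> 'h) inner"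
  by unfold_locales
    (simp_all add: scalar_conj_real algebra_simps inner_add_left inner_commute power2_norm_eq_inner)

lemma hilbert_space_complex: "hilbert_space ((*) :: complex \<Rightarrow> _) (\<lambda>x y. x * cnj y)"
  by unfold_locales
    (simp_all add: scalar_conj_complex algebra_simps scaleR_conv_of_real complex_norm_square del: of_real_power)

definition orthonormal_basis ::
    "('k::{real_normed_field,euclidean_space} \<Rightarrow> 'h::banach \<Rightarrow> 'h) \<Rightarrow> ('h \<Rightarrow> 'h \<Rightarrow> 'k) \<Rightarrow>
     (nat \<Rightarrow> 'h) \<Rightarrow> bool" where
  "orthonormal_basis smul ip \<phi> \<longleftrightarrow>
     (\<forall>i j. ip (\<phi> i) (\<phi> j) = (if i = j then 1 else 0)) \<and>
     closure (module.span smul (range \<phi>)) = UNIV"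


section \<open>Unbounded selfadjoint operators\<close>

text \<open>An operator is given by its domain \<open>D\<close> and a map \<open>A\<close>, whose values outside \<open>D\<close> are irrelevant.\<close>

definition linear_operator ::
    "('k::{real_normed_field,euclidean_space} \<Rightarrow> 'h::banach \<Rightarrow> 'h) \<Rightarrow> 'h set \<Rightarrow> ('h \<Rightarrow> 'h) \<Rightarrow> bool" where
  "linear_operator smul D A \<longleftrightarrow>
     module.subspace smul D \<and>
     (\<forall>x\<in>D. \<forall>y\<in>D. A (x + y) = A x + A y) \<and>
     (\<forall>a. \<forall>x\<in>D. A (smul a x) = smul a (A x))"

definition adjoint_domain ::
    "('h::banach \<Rightarrow> 'h \<Rightarrow> 'k) \<Rightarrow> 'h set \<Rightarrow> ('h \<Rightarrow> 'h) \<Rightarrow> 'h set" where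
  "adjoint_domain ip D A = {y. \<exists>z. \<forall>x\<in>D. ip (A x) y = ip x z}"

definition adjoint_map ::
    "('h::banach \<Rightarrow> 'h \<Rightarrow> 'k) \<Rightarrow> 'h set \<Rightarrow> ('h \<Rightarrow> 'h) \<Rightarrow> 'h \<Rightarrow> 'h" where
  "adjoint_map ip D A y = (THE z. \<forall>x\<in>D. ip (A x) y = ip x z)"

definition selfadjoint ::
    "('k::{real_normed_field,euclidean_space} \<Rightarrow> 'h::banach \<Rightarrow> 'h) \<Rightarrow> ('h \<Rightarrow> 'h \<Rightarrow> 'k) \<Rightarrow>
     'h set \<Rightarrow> ('h \<Rightarrow> 'h) \<Rightarrow> bool" where
  "selfadjoint smul ip D A \<longleftrightarrow>
     linear_operator smul D A \<and> closure D = UNIV \<and>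
     adjoint_domain ip D A = D \<and> (\<forall>y\<in>D. adjoint_map ip D A y = A y)"

definition graph_norm :: "('h::real_normed_vector \<Rightarrow> 'h) \<Rightarrow> 'h \<Rightarrow> real" where
  "graph_norm A x = norm x + norm (A x)"

definition continuous_graph_norm ::
    "real set \<Rightarrow> 'h set \<Rightarrow> ('h::real_normed_vector \<Rightarrow> 'h) \<Rightarrow> (real \<Rightarrow> 'h) \<Rightarrow> bool" where
  "continuous_graph_norm I D A u \<longleftrightarrow>
     (\<forall>t\<in>I. u t \<in> D) \<and>
     (\<forall>t\<in>I. ((\<lambda>s. graph_norm A (u s - u t)) \<longlongrightarrow> 0) (at t within I))"


section \<open>Differentiability classes on an interval\<close>

text \<open>Derivatives at the endpoints of \<open>I\<close> are one-sided.\<close>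

definition C1_on :: "real set \<Rightarrow> (real \<Rightarrow> 'b::real_normed_vector) \<Rightarrow> bool" where
  "C1_on I u \<longleftrightarrow>
     (\<exists>u'. (\<forall>t\<in>I. (u has_vector_derivative u' t) (at t within I)) \<and> continuous_on I u')"

definition C2_on_with ::
    "real set \<Rightarrow> (real \<Rightarrow> 'b::real_normed_vector) \<Rightarrow> (real \<Rightarrow> 'b) \<Rightarrow> (real \<Rightarrow> 'b) \<Rightarrow> bool" where
  "C2_on_with I u u' u'' \<longleftrightarrow>
     (\<forall>t\<in>I. (u has_vector_derivative u' t) (at t within I)) \<and>
     (\<forall>t\<in>I. (u' has_vector_derivative u'' t) (at t within I)) \<and>
     continuous_on I u''"


section \<open>Convolution and the resolvent kernel\<close>

definition conv :: "(real \<Rightarrow> real) \<Rightarrow> (real \<Rightarrow> 'b::real_normed_vector) \<Rightarrow> real \<Rightarrow> 'b" where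
  "conv a b t = integral {0..t} (\<lambda>s. a (t - s) *\<^sub>R b s)"

abbreviation int2 :: "(real \<Rightarrow> 'b::real_normed_vector) \<Rightarrow> real \<Rightarrow> 'b" where
  "int2 g \<equiv> conv (\<lambda>t. t) g"

primrec iterated_kernel :: "(real \<Rightarrow> real) \<Rightarrow> nat \<Rightarrow> real \<Rightarrow> real" where
  "iterated_kernel g 0 = g"
| "iterated_kernel g (Suc m) = conv g (iterated_kernel g m)"

text \<open>With \<open>V v = conv (int2 h) v\<close>, this is the kernel of the operator \<open>K\<close> for which
  \<open>I + \<lambda>K\<close> is the inverse of \<open>I - \<lambda>V\<close> on \<open>C([0,T])\<close>; this is the theorem
  \<open>resolvent_kernel_inverse\<close> at the end of the theory.
  Indices are shifted by one: \<open>iterated_kernel (int2 h) m\<close> is the \<open>(m+1)\<close>-st iterate.\<close>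

definition resolvent_kernel :: "(real \<Rightarrow> real) \<Rightarrow> real \<Rightarrow> real \<Rightarrow> real" where
  "resolvent_kernel h lam t = (\<Sum>m. lam ^ m * iterated_kernel (int2 h) m t)"


section \<open>The coefficients of the problem and its solutions\<close>

definition f_tilde ::
    "('h \<Rightarrow> 'h \<Rightarrow> 'k::{real_normed_field,euclidean_space}) \<Rightarrow> 'h \<Rightarrow> (real \<Rightarrow> 'h) \<Rightarrow> real \<Rightarrow> 'k" where
  "f_tilde ip \<phi>j f = int2 (\<lambda>s. ip (f s) \<phi>j)"

definition c_coef ::
    "('h \<Rightarrow> 'h \<Rightarrow> 'k::{real_normed_field,euclidean_space}) \<Rightarrow> real \<Rightarrow> (real \<Rightarrow> real) \<Rightarrow>
     (real \<Rightarrow> 'h) \<Rightarrow> 'h \<Rightarrow> 'h \<Rightarrow> real \<Rightarrow> 'h \<Rightarrow> 'k" where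
  "c_coef ip T h f u0 u2 lam \<phi>j =
     (let k = resolvent_kernel h lam in
        (ip u2 \<phi>j - ip u0 \<phi>j - f_tilde ip \<phi>j f T
           - of_real lam * conv k (\<lambda>s. ip u0 \<phi>j + f_tilde ip \<phi>j f s) T)
        / of_real (T + lam * conv k (\<lambda>s. s) T))"

definition L_coef ::
    "('h \<Rightarrow> 'h \<Rightarrow> 'k::{real_normed_field,euclidean_space}) \<Rightarrow> real \<Rightarrow> (real \<Rightarrow> real) \<Rightarrow>
     (real \<Rightarrow> 'h) \<Rightarrow> 'h \<Rightarrow> 'h \<Rightarrow> real \<Rightarrow> 'h \<Rightarrow> real" where
  "L_coef ip T h f u0 u2 lam \<phi>j =
     (norm (ip u0 \<phi>j))\<^sup>2 + T\<^sup>2 * (norm (c_coef ip T h f u0 u2 lam \<phi>j))\<^sup>2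
       + (SUP t\<in>{0..T}. (norm (f_tilde ip \<phi>j f t))\<^sup>2)"

definition M_const :: "real \<Rightarrow> (real \<Rightarrow> real) \<Rightarrow> real" where
  "M_const T h = T * integral {0..T} (\<lambda>t. \<bar>h t\<bar>)"

definition is_solution ::
    "real \<Rightarrow> 'h::banach set \<Rightarrow> ('h \<Rightarrow> 'h) \<Rightarrow> (real \<Rightarrow> real) \<Rightarrow> (real \<Rightarrow> 'h) \<Rightarrow> 'h \<Rightarrow> 'h \<Rightarrow>
     (real \<Rightarrow> 'h) \<Rightarrow> bool" where
  "is_solution T D A h f u0 u2 u \<longleftrightarrow>
     (\<exists>u' u''. C2_on_with {0..T} u u' u'' \<and>
        (\<forall>t\<in>{0..T}. u'' t = conv h (\<lambda>s. A (u s)) t + f t)) \<and>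
     continuous_graph_norm {0..T} D A u \<and>
     u 0 = u0 \<and> u T = u2"


section \<open>The series represents the resolvent\<close>

lemma continuous_clamp:
  assumes "continuous_on {0..T} a" "0 \<le> (T::real)"
  shows "continuous_on UNIV (\<lambda>x. a (max 0 (min T x)))"
  by (rule continuous_on_compose2[OF assms(1)]) (use assms(2) in \<open>auto intro!: continuous_intros\<close>)

lemma conv_integrable:
  fixes b :: "real \<Rightarrow> 'b::banach"
  assumes "continuous_on {0..T} a" "continuous_on {0..T} b" "t \<in> {0..T}"
  shows "(\<lambda>s. a (t - s) *\<^sub>R b s) integrable_on {0..t}"
  by (rule integrable_continuous_interval)
    (use assms in \<open>auto intro!: continuous_intros intro: continuous_on_subset
        continuous_on_compose2[OF assms(1)]\<close>)

lemma continuous_conv: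
  fixes b :: "real \<Rightarrow> 'b::banach"
  assumes a: "continuous_on {0..T} a" and b: "continuous_on {0..T} b"
  shows "continuous_on {0..T} (conv a b)"
proof (cases "0 \<le> T")
  case True
  define a' where "a' = (\<lambda>x. a (max 0 (min T x)))"
  define b' where "b' = (\<lambda>x. b (max 0 (min T x)))"
  have ca: "continuous_on UNIV a'" and cb: "continuous_on UNIV b'"
    unfolding a'_def b'_def by (intro continuous_clamp a b True)+
  have eq: "conv a b t = t *\<^sub>R integral (cbox 0 1) (\<lambda>x. a' (t - t * x) *\<^sub>R b' (t * x))" if "t \<in> {0..T}" for t
  proof (cases "t = 0")
    case True then show ?thesis by (simp add: conv_def)
  next
    case False
    then have t: "t > 0" using that by auto
    have "((\<lambda>s. a (t - s) *\<^sub>R b s) has_integral conv a b t) (cbox 0 t)"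
      unfolding conv_def using conv_integrable[OF a b that] by (simp add: integrable_integral)
    from has_integral_affinity[OF this, of t 0] t
    have "((\<lambda>x. a (t - t * x) *\<^sub>R b (t * x)) has_integral conv a b t /\<^sub>R t) (cbox 0 1)"
      by (simp add: image_affinity_cbox inverse_eq_divide)
    then have "conv a b t = t *\<^sub>R integral (cbox 0 1) (\<lambda>x. a (t - t * x) *\<^sub>R b (t * x))"
      using t by (simp add: integral_unique)
    also have "integral (cbox 0 1) (\<lambda>x. a (t - t * x) *\<^sub>R b (t * x)) =
      integral (cbox 0 1) (\<lambda>x. a' (t - t * x) *\<^sub>R b' (t * x))"
    proof (rule integral_cong)
      fix x :: real assume "x \<in> cbox 0 1"
      then have "0 \<le> t * x" "t * x \<le> t" using t by (auto simp: mult_left_le)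
      with that have "max 0 (min T (t - t * x)) = t - t * x" "max 0 (min T (t * x)) = t * x" by auto
      then show "a (t - t * x) *\<^sub>R b (t * x) = a' (t - t * x) *\<^sub>R b' (t * x)"
        by (simp add: a'_def b'_def)
    qed
    finally show ?thesis .
  qed
  have "continuous_on UNIV (\<lambda>t. integral (cbox 0 1) (\<lambda>x. a' (t - t * x) *\<^sub>R b' (t * x)))"
    by (rule integral_continuous_on_param)
      (auto simp: split_beta intro!: continuous_intros continuous_on_compose2[OF ca] continuous_on_compose2[OF cb])
  then have "continuous_on {0..T} (\<lambda>t. t *\<^sub>R integral (cbox 0 1) (\<lambda>x. a' (t - t * x) *\<^sub>R b' (t * x)))"
    by (auto intro!: continuous_intros intro: continuous_on_subset)
  then show ?thesis by (simp add: eq cong: continuous_on_cong_simp)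
qed simp

lemma conv_commute:
  fixes a b :: "real \<Rightarrow> real"
  assumes "continuous_on {0..T} a" "continuous_on {0..T} b" "t \<in> {0..T}"
  shows "conv a b t = conv b a t"
proof -
  have "((\<lambda>s. a (t - s) *\<^sub>R b s) has_integral conv a b t) (cbox 0 t)"
    unfolding conv_def using conv_integrable[OF assms] by (simp add: integrable_integral)
  from has_integral_affinity[OF this, of "-1" t]
  have "((\<lambda>s. b (t - s) *\<^sub>R a s) has_integral conv a b t) (cbox 0 t)"
    using assms(3) by (simp add: image_affinity_cbox mult.commute)
  then show ?thesis unfolding conv_def[of b a] by (simp add: integral_unique)
qed

lemma triangle_swap:
  fixes F :: "real \<Rightarrow> real \<Rightarrow> 'b::euclidean_space"
  assumes F: "continuous_on UNIV (\<lambda>(s, r). F s r)"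
  shows "integral {0..t} (\<lambda>s. integral {0..s} (\<lambda>r. F s r)) = integral {0..t} (\<lambda>r. integral {r..t} (\<lambda>s. F s r))"
proof -
  define G where "G = (\<lambda>s r. indicator {p. 0 \<le> snd p \<and> snd p \<le> fst p \<and> fst p \<le> t} (s, r) *\<^sub>R F s r)"
  have cl: "compact {p::real \<times> real. 0 \<le> snd p \<and> snd p \<le> fst p \<and> fst p \<le> t}"
  proof -
    have "closed {p::real \<times> real. 0 \<le> snd p \<and> snd p \<le> fst p \<and> fst p \<le> t}"
      by (intro closed_Collect_conj closed_Collect_le continuous_intros)
    moreover have "{p::real \<times> real. 0 \<le> snd p \<and> snd p \<le> fst p \<and> fst p \<le> t} \<subseteq> cbox (0,0) (t,t)"
      by (auto simp: cbox_Pair_eq)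
    ultimately show ?thesis by (meson bounded_cbox bounded_subset compact_eq_bounded_closed)
  qed
  have int: "integrable (lborel \<Otimes>\<^sub>M lborel) (\<lambda>(s, r). G s r)"
  proof -
    have "set_integrable lborel {p::real \<times> real. 0 \<le> snd p \<and> snd p \<le> fst p \<and> fst p \<le> t} (\<lambda>(s, r). F s r)"
      by (rule borel_integrable_compact[OF cl, folded set_integrable_def]) (rule continuous_on_subset[OF F], simp)
    then show ?thesis unfolding set_integrable_def lborel_prod G_def by (simp add: case_prod_unfold)
  qed
  have cF: "continuous_on S (\<lambda>r. F s r)" "continuous_on S (\<lambda>s. F s r)" for S s r
    by (rule continuous_on_compose2[OF F, where f="\<lambda>x. (_, x)", simplified split]; auto intro!: continuous_intros)
       (rule continuous_on_compose2[OF F, where f="\<lambda>x. (x, _)", simplified split]; auto intro!: continuous_intros)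
  have I: "integral\<^sup>L lborel (\<lambda>x. indicator {c..d} x *\<^sub>R g x) = integral {c..d} g"
     if "set_integrable lborel {c..d} g" for c d and g :: "real \<Rightarrow> 'b"
    using set_borel_integral_eq_integral(2)[OF that] by (simp add: set_lebesgue_integral_def)
  have si: "set_integrable lborel {c..d} g" if "continuous_on {c..d} g" for c d and g :: "real \<Rightarrow> 'b"
    using borel_integrable_compact[OF _ that] by (simp add: set_integrable_def)
  have G1: "integral\<^sup>L lborel (G s) = indicator {0..t} s *\<^sub>R integral {0..s} (F s)" for s
  proof -
    have "G s = (\<lambda>r. indicator {0..t} s *\<^sub>R indicator {0..s} r *\<^sub>R F s r)"
      by (auto simp: G_def indicator_def)
    then show ?thesis using I[OF si[OF cF(1)], of 0 s s] by (simp del: scaleR_scaleR)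
  qed
  have G2: "integral\<^sup>L lborel (\<lambda>s. G s r) = indicator {0..t} r *\<^sub>R integral {r..t} (\<lambda>s. F s r)" for r
  proof -
    have "(\<lambda>s. G s r) = (\<lambda>s. indicator {0..t} r *\<^sub>R indicator {r..t} s *\<^sub>R F s r)"
      by (auto simp: G_def indicator_def)
    then show ?thesis using I[OF si[OF cF(2)], of r t r] by (simp del: scaleR_scaleR)
  qed
  have "integral {0..t} (\<lambda>s. integral {0..s} (\<lambda>r. F s r)) = (\<integral>s. (\<integral>r. G s r \<partial>lborel) \<partial>lborel)"
    unfolding G1 using lborel_pair.integrable_fst'[OF int] unfolding split_conv G1
    by (subst I) (auto simp: set_integrable_def)
  also have "\<dots> = (\<integral>r. (\<integral>s. G s r \<partial>lborel) \<partial>lborel)"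
    by (rule lborel_pair.Fubini_integral[OF int, symmetric])
  also have "\<dots> = integral {0..t} (\<lambda>r. integral {r..t} (\<lambda>s. F s r))"
    unfolding G2 using lborel_pair.integrable_fst'[OF lborel_pair.integrable_product_swap[OF int]] unfolding split_conv G2
    by (subst I) (auto simp: set_integrable_def)
  finally show ?thesis .
qed

lemma conv_assoc:
  fixes v :: "real \<Rightarrow> 'b::euclidean_space"
  assumes a: "continuous_on {0..T} a" and b: "continuous_on {0..T} b" and v: "continuous_on {0..T} v"
    and t: "t \<in> {0..T}"
  shows "conv a (conv b v) t = conv (conv a b) v t"
proof -
  define cl where "cl = (\<lambda>x. max 0 (min T x))"
  have T: "0 \<le> T" using t by auto
  have [simp]: "cl x = x" if "0 \<le> x" "x \<le> T" for x using that by (simp add: cl_def)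
  have c: "continuous_on UNIV (\<lambda>x. a (cl x))" "continuous_on UNIV (\<lambda>x. b (cl x))"
    "continuous_on UNIV (\<lambda>x. v (cl x))"
    unfolding cl_def by (intro continuous_clamp a b v T)+
  define F where "F = (\<lambda>s r. (a (cl (t - s)) * b (cl (s - r))) *\<^sub>R v (cl r))"
  have F: "continuous_on UNIV (\<lambda>(s, r). F s r)"
    unfolding F_def split_beta
    by (intro continuous_intros continuous_on_compose2[OF c(1)] continuous_on_compose2[OF c(2)]
         continuous_on_compose2[OF c(3)]) auto
  have "conv a (conv b v) t = integral {0..t} (\<lambda>s. integral {0..s} (\<lambda>r. F s r))"
    unfolding conv_def integral_cmul[symmetric]
    using t by (intro integral_cong) (auto simp: F_def)
  also have "\<dots> = integral {0..t} (\<lambda>r. integral {r..t} (\<lambda>s. F s r))"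
    by (rule triangle_swap[OF F])
  also have "\<dots> = conv (conv a b) v t"
    unfolding conv_def[of "conv a b"]
  proof (rule integral_cong)
    fix r assume r: "r \<in> {0..t}"
    have "((\<lambda>q. a (t - r - q) *\<^sub>R b q) has_integral conv a b (t - r)) (cbox 0 (t - r))"
      unfolding conv_def using conv_integrable[OF a b, of "t - r"] r t by (simp add: integrable_integral)
    from has_integral_affinity[OF this, of 1 "- r"] r
    have "((\<lambda>s. a (t - s) * b (s - r)) has_integral conv a b (t - r)) {r..t}"
      by (simp add: image_affinity_cbox)
    from has_integral_scaleR_left[OF this, of "v r"]
    have "((\<lambda>s. F s r) has_integral conv a b (t - r) *\<^sub>R v r) {r..t}"
      by (rule has_integral_eq[rotated]) (use r t in \<open>auto simp: F_def\<close>)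
    then show "integral {r..t} (\<lambda>s. F s r) = conv a b (t - r) *\<^sub>R v r"
      by (rule integral_unique)
  qed
  finally show ?thesis .
qed

lemma conv_bound:
  assumes a: "continuous_on {0..T} a" and b: "continuous_on {0..T} b"
    and t: "t \<in> {0..T}"
    and B: "\<And>x. x \<in> {0..T} \<Longrightarrow> \<bar>a x\<bar> \<le> B" and b': "\<And>x. x \<in> {0..T} \<Longrightarrow> \<bar>b x\<bar> \<le> C * x ^ m"
  shows "\<bar>conv a b t\<bar> \<le> B * C * t ^ Suc m / Suc m"
proof -
  have "\<bar>conv a b t\<bar> \<le> integral {0..t} (\<lambda>s. B * (C * s ^ m))"
    unfolding conv_def real_norm_def[symmetric]
  proof (rule integral_norm_bound_integral[OF conv_integrable[OF a b t]])
    show "(\<lambda>s. B * (C * s ^ m)) integrable_on {0..t}"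
      by (intro integrable_continuous_interval continuous_intros)
    fix s assume "s \<in> {0..t}"
    then show "norm (a (t - s) *\<^sub>R b s) \<le> B * (C * s ^ m)"
      using t B[of "t - s"] b'[of s] abs_ge_zero[of "a (t - s)"]
      by (auto simp: abs_mult intro!: mult_mono)
  qed
  also have "((\<lambda>s. B * (C * s ^ m)) has_integral B * C * t ^ Suc m / Suc m - B * C * 0 ^ Suc m / Suc m) {0..t}"
  proof (rule fundamental_theorem_of_calculus)
    show "0 \<le> t" using t by auto
    fix x :: real
    have "((\<lambda>t. B * C * t ^ Suc m / Suc m) has_real_derivative B * C * (Suc m * x ^ m) / Suc m) (at x within {0..t})"
      using DERIV_cdivide[OF DERIV_cmult[OF DERIV_pow[of "Suc m" x "{0..t}"], of "B * C"], of "Suc m"]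
      by (simp del: of_nat_Suc power_Suc)
    moreover have "B * C * (Suc m * x ^ m) / Suc m = B * (C * x ^ m)"
      by (simp del: of_nat_Suc)
    ultimately show "((\<lambda>t. B * C * t ^ Suc m / Suc m) has_vector_derivative B * (C * x ^ m)) (at x within {0..t})"
      by (simp add: has_real_derivative_iff_has_vector_derivative)
  qed
  from integral_unique[OF this]
  have "integral {0..t} (\<lambda>s. B * (C * s ^ m)) = B * C * t ^ Suc m / Suc m"
    by (simp del: integral_mult_right)
  finally show ?thesis .
qed

lemma continuous_iterated_kernel:
  assumes "continuous_on {0..T} g"
  shows "continuous_on {0..T} (iterated_kernel g m)"
  by (induction m) (simp_all add: assms continuous_conv)

lemma iterated_kernel_bound:
  assumes g: "continuous_on {0..T} g" and B: "\<And>x. x \<in> {0..T} \<Longrightarrow> \<bar>g x\<bar> \<le> B"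
    and t: "t \<in> {0..T}"
  shows "\<bar>iterated_kernel g m t\<bar> \<le> B ^ Suc m / fact m * t ^ m"
  using t
proof (induction m arbitrary: t)
  case 0
  then show ?case using B by simp
next
  case (Suc m)
  have "\<bar>iterated_kernel g (Suc m) t\<bar> \<le> B * (B ^ Suc m / fact m) * t ^ Suc m / Suc m"
    unfolding iterated_kernel.simps
    by (rule conv_bound[OF g continuous_iterated_kernel[OF g] Suc.prems B Suc.IH])
  also have "\<dots> = B ^ Suc (Suc m) / fact (Suc m) * t ^ Suc m"
    by (simp add: field_simps)
  finally show ?case .
qed

lemma resolvent_kernel_eq:
  assumes h: "continuous_on {0..T} h"
  shows "continuous_on {0..T} (resolvent_kernel h lam)"
    and "t \<in> {0..T} \<Longrightarrow>
      resolvent_kernel h lam t = int2 h t + lam * conv (int2 h) (resolvent_kernel h lam) t"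
proof -
  define g where "g = int2 h"
  let ?k = "resolvent_kernel h lam"
  have g: "continuous_on {0..T} g" unfolding g_def by (intro continuous_conv h continuous_intros)
  have "compact (g ` {0..T})" using g by (rule compact_continuous_image) simp
  then obtain B where B': "\<And>y. y \<in> g ` {0..T} \<Longrightarrow> norm y \<le> B"
    using compact_imp_bounded bounded_iff by metis
  have B: "\<bar>g x\<bar> \<le> B" if "x \<in> {0..T}" for x using B'[of "g x"] that by auto
  have B0: "0 \<le> B" if "x \<in> {0..T}" for x using B[OF that] by linarith
  define c where "c = (\<lambda>m. B * ((\<bar>lam\<bar> * B * T) ^ m / fact m))"
  have c: "summable c" unfolding c_def
    by (intro summable_mult) (use summable_exp[of "\<bar>lam\<bar> * B * T"] in \<open>simp add: field_simps\<close>)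
  have bd: "norm (lam ^ m * iterated_kernel g m x) \<le> c m" if x: "x \<in> {0..T}" for m x
  proof -
    have "norm (lam ^ m * iterated_kernel g m x) \<le> \<bar>lam\<bar> ^ m * (B ^ Suc m / fact m * x ^ m)"
      unfolding real_norm_def abs_mult power_abs
      by (intro mult_left_mono iterated_kernel_bound[OF g B x]) auto
    also have "\<dots> \<le> \<bar>lam\<bar> ^ m * (B ^ Suc m / fact m * T ^ m)"
      using x B0[OF x] by (intro mult_left_mono power_mono) auto
    also have "\<dots> = c m" by (simp add: c_def power_mult_distrib)
    finally show ?thesis .
  qed
  have ul: "uniform_limit {0..T} (\<lambda>n x. \<Sum>m<n. lam ^ m * iterated_kernel g m x) ?k sequentially"
    unfolding resolvent_kernel_def[abs_def] g_def[symmetric]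
    by (rule Weierstrass_m_test[OF bd c])
  show k: "continuous_on {0..T} ?k"
    by (rule uniform_limit_theorem[OF _ ul])
      (auto intro!: always_eventually continuous_intros continuous_iterated_kernel g)
  show "?k t = int2 h t + lam * conv (int2 h) ?k t" if t: "t \<in> {0..T}"
  proof -
    have "(\<lambda>m. lam ^ m * iterated_kernel g m t) sums ?k t"
      using summable_comparison_test'[OF c bd[OF t]] 
      by (simp add: resolvent_kernel_def g_def summable_sums)
    then have S1: "(\<lambda>m. lam ^ Suc m * iterated_kernel g (Suc m) t) sums (?k t - g t)"
      by (subst sums_Suc_iff) simp
    let ?f = "\<lambda>m s. g (t - s) * (lam ^ m * iterated_kernel g m s)"
    have st: "{0..t} \<subseteq> {0..T}" using t by auto
    have U: "uniform_limit {0..t} (\<lambda>n s. \<Sum>m<n. ?f m s) (\<lambda>s. \<Sum>m. ?f m s) sequentially"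
    proof (rule Weierstrass_m_test[OF _ summable_mult[OF c, of B]])
      fix m s assume s: "s \<in> {0..t}"
      show "norm (?f m s) \<le> B * c m"
        using B[of "t - s"] bd[of s m] s t B0[OF t]
        by (auto simp: abs_mult[of "g _"] intro!: mult_mono)
    qed
    have E: "(\<Sum>m. ?f m s) = g (t - s) * ?k s" if "s \<in> {0..t}" for s
      unfolding resolvent_kernel_def g_def[symmetric]
      by (rule suminf_mult) (rule summable_comparison_test'[OF c bd], use that t in auto)
    have "uniform_limit {0..t} (\<lambda>n s. \<Sum>m<n. ?f m s) (\<lambda>s. g (t - s) * ?k s) sequentially"
      by (rule iffD1[OF uniform_limit_cong' U]) (simp_all only: E)
    moreover have cf: "continuous_on {0..t} (\<lambda>s. ?f m s)" for m
      using t by (intro continuous_intros continuous_on_compose2[OF g]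
          continuous_on_subset[OF continuous_iterated_kernel[OF g] st]) auto
    then have "continuous_on {0..t} (\<lambda>s. \<Sum>m<n. ?f m s)" for n
      by (rule continuous_on_sum)
    ultimately obtain I J where I: "\<And>n. ((\<lambda>s. \<Sum>m<n. ?f m s) has_integral I n) {0..t}"
      and J: "((\<lambda>s. g (t - s) * ?k s) has_integral J) {0..t}" and IJ: "I \<longlonglongrightarrow> J"
      by (rule uniform_limit_integral[OF _ _ sequentially_bot]) blast
    have "I n = (\<Sum>m<n. lam ^ m * iterated_kernel g (Suc m) t)" for n
    proof -
      have "((\<lambda>s. \<Sum>m<n. ?f m s) has_integral (\<Sum>m<n. integral {0..t} (?f m))) {0..t}"
        by (intro has_integral_sum integrable_integral integrable_continuous_interval cf) auto
      then have "I n = (\<Sum>m<n. integral {0..t} (?f m))" using I has_integral_unique by blast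
      moreover have "integral {0..t} (?f m) = lam ^ m * iterated_kernel g (Suc m) t" for m
        by (simp add: conv_def mult.left_commute)
      ultimately show ?thesis by simp
    qed
    then have "I = (\<lambda>n. \<Sum>m<n. lam ^ m * iterated_kernel g (Suc m) t)" by (rule ext)
    with IJ have "(\<lambda>m. lam ^ m * iterated_kernel g (Suc m) t) sums J"
      by (simp add: sums_def)
    from sums_mult[OF this, of lam] have "(\<lambda>m. lam ^ Suc m * iterated_kernel g (Suc m) t) sums (lam * J)"
      by (simp add: mult.assoc)
    with S1 have "?k t - g t = lam * J" by (rule sums_unique2)
    moreover have "J = conv g ?k t" using J by (simp add: conv_def integral_unique)
    ultimately show ?thesis by (simp add: g_def)
  qed
qed

lemma conv_cong:
  assumes "\<And>s. s \<in> {0..t} \<Longrightarrow> a s = a' s" "\<And>s. s \<in> {0..t} \<Longrightarrow> b s = b' s"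
  shows "conv a b t = conv a' b' t"
  unfolding conv_def using assms by (intro integral_cong) auto

lemma conv_add_scale:
  fixes v w :: "real \<Rightarrow> 'b::banach"
  assumes a: "continuous_on {0..T} a" and b: "continuous_on {0..T} b"
    and v: "continuous_on {0..T} v" and w: "continuous_on {0..T} w" and t: "t \<in> {0..T}"
  shows "conv a (\<lambda>s. v s + c *\<^sub>R w s) t = conv a v t + c *\<^sub>R conv a w t"
    and "conv (\<lambda>s. a s + c * b s) v t = conv a v t + c *\<^sub>R conv b v t"
proof -
  note i = integrable_integral[OF conv_integrable[OF a v t]]
    integrable_integral[OF conv_integrable[OF a w t]]
    integrable_integral[OF conv_integrable[OF b v t]]
  show "conv a (\<lambda>s. v s + c *\<^sub>R w s) t = conv a v t + c *\<^sub>R conv a w t"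
    unfolding conv_def 
    using has_integral_add[OF i(1) has_integral_cmul[OF i(2), of c]]
    by (intro integral_unique) (simp add: algebra_simps)
  show "conv (\<lambda>s. a s + c * b s) v t = conv a v t + c *\<^sub>R conv b v t"
    unfolding conv_def 
    using has_integral_add[OF i(1) has_integral_cmul[OF i(3), of c]]
    by (intro integral_unique) (simp add: algebra_simps)
qed

theorem resolvent_kernel_inverse:
  fixes h :: "real \<Rightarrow> real" and lam :: real and v :: "real \<Rightarrow> 'k::euclidean_space"
  defines "V \<equiv> \<lambda>v. conv (int2 h) v" and "K \<equiv> \<lambda>v. conv (resolvent_kernel h lam) v"
  assumes h: "continuous_on {0..T} h" and v: "continuous_on {0..T} v" and t: "t \<in> {0..T}"
  shows "continuous_on {0..T} (resolvent_kernel h lam)"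
    and "(v t + lam *\<^sub>R K v t) - lam *\<^sub>R V (\<lambda>s. v s + lam *\<^sub>R K v s) t = v t"
    and "(v t - lam *\<^sub>R V v t) + lam *\<^sub>R K (\<lambda>s. v s - lam *\<^sub>R V v s) t = v t"
proof -
  let ?g = "int2 h" and ?k = "resolvent_kernel h lam"
  have g: "continuous_on {0..T} ?g" by (intro continuous_conv h continuous_intros)
  note k = resolvent_kernel_eq(1)[OF h, of lam]
  note gk = continuous_conv[OF g k]
  show "continuous_on {0..T} ?k" by (rule k)
  have kv: "K v t = V v t + lam *\<^sub>R conv (conv ?g ?k) v t"
    unfolding K_def V_def conv_add_scale(2)[OF g gk v v t, symmetric]
    by (rule conv_cong) (use resolvent_kernel_eq(2)[OF h] t in auto)
  have "V (\<lambda>s. v s + lam *\<^sub>R K v s) t = V v t + lam *\<^sub>R V (K v) t"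
    unfolding V_def K_def by (rule conv_add_scale(1)[OF g k v continuous_conv[OF k v] t])
  moreover have "V (K v) t = conv (conv ?g ?k) v t"
    unfolding V_def K_def by (rule conv_assoc[OF g k v t])
  ultimately show "(v t + lam *\<^sub>R K v t) - lam *\<^sub>R V (\<lambda>s. v s + lam *\<^sub>R K v s) t = v t"
    using kv by simp
  have "K (\<lambda>s. v s + (- lam) *\<^sub>R V v s) t = K v t + (- lam) *\<^sub>R K (V v) t"
    unfolding V_def K_def by (rule conv_add_scale(1)[OF k g v continuous_conv[OF g v] t])
  moreover have "K (V v) t = conv (conv ?g ?k) v t"
    unfolding V_def K_def conv_assoc[OF k g v t]
    by (rule conv_cong) (use conv_commute[OF k g] t in auto)
  ultimately show "(v t - lam *\<^sub>R V v t) + lam *\<^sub>R K (\<lambda>s. v s - lam *\<^sub>R V v s) t = v t"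
    using kv by simp
qed

end

theory Submission
  imports Defs
begin

text \<open>Integrating twice, the \<open>j\<close>-th Fourier coefficient \<open>p\<close> of a solution satisfies the scalar Volterra
  equation \<open>p = w + lam V p\<close> with \<open>w t = u\<^sub>0 + t c + int2 f t\<close>, so \<open>p = w + lam K w\<close>; the value at \<open>T\<close>
  determines \<open>c\<close>, which gives uniqueness. Conversely the kernel bound \<open>k t \<le> M exp (lam M t)\<close> gives
  \<open>|p|\<^sup>2 \<le> 3 L exp (2 lam M T)\<close>, so the series with coefficients \<open>p\<close> and \<open>lam p\<close> converge uniformly to
  \<open>u\<close> and, \<open>A\<close> being closed, to \<open>A u\<close>. No series has to be differentiated:
  \<open>u\<^sub>0 + t c + int2 (h * A u + f)\<close> is of class \<open>C\<^sup>2\<close> and has the same coefficients as \<open>u\<close>.\<close>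

section \<open>Volterra equations\<close>

lemma conv_bounded_linear:
  fixes b :: "real \<Rightarrow> 'b::banach"
  assumes L: "bounded_linear L"
    and ab: "continuous_on {0..T} a" "continuous_on {0..T} b" "t \<in> {0..T}"
  shows "conv a (\<lambda>s. L (b s)) t = L (conv a b t)"
proof -
  have "integral {0..t} (L \<circ> (\<lambda>s. a (t - s) *\<^sub>R b s)) = L (conv a b t)"
    unfolding conv_def by (rule integral_linear[OF conv_integrable[OF ab] L])
  then show ?thesis
    by (simp add: conv_def comp_def linear_cmul[OF bounded_linear.linear[OF L]])
qed

lemma conv_add:
  fixes v w :: "real \<Rightarrow> 'b::banach"
  assumes "continuous_on {0..T} a" "continuous_on {0..T} v" "continuous_on {0..T} w" "t \<in> {0..T}"
  shows "conv a (\<lambda>s. v s + w s) t = conv a v t + conv a w t"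
  using conv_add_scale(1)[OF assms(1,1-4), of 1] by simp

text \<open>Splitting the weight \<open>x - s\<close> takes the variable \<open>x\<close> out of the
  integrand, so the product rule and the fundamental theorem of calculus apply; the two boundary
  terms \<open>t *\<^sub>R g t\<close> cancel.\<close>

lemma int2_has_vector_derivative:
  fixes g :: "real \<Rightarrow> 'b::banach"
  assumes g: "continuous_on {0..T} g" and t: "t \<in> {0..T}"
  shows "(int2 g has_vector_derivative integral {0..t} g) (at t within {0..T})"
proof -
  have sg: "continuous_on {0..T} (\<lambda>s. s *\<^sub>R g s)" by (intro continuous_intros g)
  have eq: "x *\<^sub>R integral {0..x} g - integral {0..x} (\<lambda>s. s *\<^sub>R g s) = int2 g x" if "x \<in> {0..T}" for x
  proof -
    have sub: "{0..x} \<subseteq> {0..T}" using that by auto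
    have i: "g integrable_on {0..x}" "(\<lambda>s. s *\<^sub>R g s) integrable_on {0..x}"
      by (intro integrable_continuous_interval continuous_on_subset[OF _ sub] g sg)+
    have "((\<lambda>s. x *\<^sub>R g s - s *\<^sub>R g s) has_integral
        x *\<^sub>R integral {0..x} g - integral {0..x} (\<lambda>s. s *\<^sub>R g s)) {0..x}"
      by (intro has_integral_diff has_integral_cmul integrable_integral i)
    then show ?thesis
      unfolding conv_def by (simp add: algebra_simps integral_unique)
  qed
  have "((\<lambda>x. x *\<^sub>R integral {0..x} g - integral {0..x} (\<lambda>s. s *\<^sub>R g s)) has_vector_derivative
      (t *\<^sub>R g t + 1 *\<^sub>R integral {0..t} g) - t *\<^sub>R g t) (at t within {0..T})"
    by (intro has_vector_derivative_diff has_vector_derivative_scaleR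
        integral_has_vector_derivative g sg t DERIV_ident)
  then have "((\<lambda>x. x *\<^sub>R integral {0..x} g - integral {0..x} (\<lambda>s. s *\<^sub>R g s)) has_vector_derivative
      integral {0..t} g) (at t within {0..T})"
    by simp
  then show ?thesis
    by (rule has_vector_derivative_transform[rotated 2]) (use t eq in auto)
qed

lemma C2_on_with_int2:
  fixes g :: "real \<Rightarrow> 'b::banach"
  assumes g: "continuous_on {0..T} g"
  shows "C2_on_with {0..T} (\<lambda>t. a + t *\<^sub>R b + int2 g t) (\<lambda>t. b + integral {0..t} g) g"
  unfolding C2_on_with_def
proof (intro conjI ballI g)
  fix t assume t: "t \<in> {0..T}"
  have "((\<lambda>t. a + t *\<^sub>R b + int2 g t) has_vector_derivative
      0 + (t *\<^sub>R 0 + 1 *\<^sub>R b) + integral {0..t} g) (at t within {0..T})"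
    by (intro has_vector_derivative_add has_vector_derivative_const has_vector_derivative_scaleR
        int2_has_vector_derivative g t DERIV_ident)
  then show "((\<lambda>t. a + t *\<^sub>R b + int2 g t) has_vector_derivative b + integral {0..t} g) (at t within {0..T})"
    by simp
  have "((\<lambda>t. b + integral {0..t} g) has_vector_derivative 0 + g t) (at t within {0..T})"
    by (intro has_vector_derivative_add has_vector_derivative_const integral_has_vector_derivative g t)
  then show "((\<lambda>t. b + integral {0..t} g) has_vector_derivative g t) (at t within {0..T})"
    by simp
qed

text \<open>Second-order Taylor formula whose integral remainder is exactly \<open>int2 u''\<close>.
  It turns the differential equation into an integral equation with the unknown slope
  \<open>u' 0\<close>.\<close>

lemma C2_on_with_taylor:
  fixes u :: "real \<Rightarrow> 'b::banach"
  assumes u: "C2_on_with {0..T} u u' u''" and t: "t \<in> {0..T}"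
  shows "u t = u 0 + t *\<^sub>R u' 0 + int2 u'' t"
proof -
  define Df where "Df = (\<lambda>i::nat. if i = 0 then u else if i = 1 then u' else u'')"
  have "((\<lambda>x. ((t - x) ^ (2 - 1) / fact (2 - 1)) *\<^sub>R Df 2 x) has_integral
      u t - (\<Sum>i<2. ((t - 0) ^ i / fact i) *\<^sub>R Df i 0)) {0..t}"
  proof (rule Taylor_has_integral)
    fix i :: nat and x :: real assume "i < 2" "0 \<le> x" "x \<le> t"
    then have "i = 0 \<or> i = 1" "x \<in> {0..T}" using t by auto
    then have "(Df i has_vector_derivative Df (Suc i) x) (at x within {0..T})"
      using u by (auto simp: Df_def C2_on_with_def)
    then show "(Df i has_vector_derivative Df (Suc i) x) (at x within {0..t})"
      by (rule has_vector_derivative_within_subset) (use t in auto)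
  qed (use t in \<open>auto simp: Df_def\<close>)
  then have "((\<lambda>x. (t - x) *\<^sub>R u'' x) has_integral u t - (u 0 + t *\<^sub>R u' 0)) {0..t}"
    by (simp add: Df_def numeral_2_eq_2)
  then show ?thesis by (simp add: conv_def integral_unique)
qed

section \<open>Bounds for the resolvent kernel\<close>

lemma int2_nonneg:
  fixes h :: "real \<Rightarrow> real"
  assumes "continuous_on {0..T} h" "\<And>t. t \<in> {0..T} \<Longrightarrow> 0 \<le> h t" "t \<in> {0..T}"
  shows "0 \<le> int2 h t"
  unfolding conv_def
  by (rule integral_nonneg[OF conv_integrable[of T "\<lambda>t. t", OF _ assms(1,3)]])
    (use assms in \<open>auto intro!: continuous_intros\<close>)

text \<open>The weight \<open>t - s\<close> is at most \<open>T\<close>, and enlarging the interval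
  increases the integral of \<open>\<bar>h s\<bar>\<close>. So \<open>M\<close> can serve as the
  bound \<open>B\<close> of \<open>iterated_kernel_bound\<close> for the kernel
  \<open>int2 h\<close>.\<close>

lemma abs_int2_le_M_const:
  assumes h: "continuous_on {0..T} h" and t: "t \<in> {0..T}"
  shows "\<bar>int2 h t\<bar> \<le> M_const T h"
proof -
  have sub: "{0..t} \<subseteq> {0..T}" using t by auto
  have i: "(\<lambda>s. \<bar>h s\<bar>) integrable_on {0..T}" "(\<lambda>s. \<bar>h s\<bar>) integrable_on {0..t}"
    by (intro integrable_continuous_interval continuous_intros h continuous_on_subset[OF h sub])+
  have "norm (int2 h t) \<le> integral {0..t} (\<lambda>s. T * \<bar>h s\<bar>)"
    unfolding conv_def
  proof (rule integral_norm_bound_integral[OF conv_integrable[of T "\<lambda>t. t", OF _ h t]])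
    fix s assume "s \<in> {0..t}"
    then show "norm ((t - s) *\<^sub>R h s) \<le> T * \<bar>h s\<bar>"
      using t by (auto simp: abs_mult intro!: mult_right_mono)
  qed (auto intro!: continuous_intros integrable_on_mult_right i)
  also have "\<dots> = T * integral {0..t} (\<lambda>s. \<bar>h s\<bar>)" by simp
  also have "\<dots> \<le> M_const T h"
    unfolding M_const_def using t by (intro mult_left_mono integral_subset_le sub i) auto
  finally show ?thesis by simp
qed

lemma iterated_kernel_nonneg:
  assumes g: "continuous_on {0..T} g" and g0: "\<And>t. t \<in> {0..T} \<Longrightarrow> 0 \<le> g t" and t: "t \<in> {0..T}"
  shows "0 \<le> iterated_kernel g m t"
  using t
proof (induction m arbitrary: t)
  case (Suc m)
  show ?case
    unfolding iterated_kernel.simps conv_def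
    by (rule integral_nonneg[OF conv_integrable[OF g continuous_iterated_kernel[OF g] Suc.prems]])
      (use Suc g0 in auto)
qed (simp add: g0)

text \<open>With \<open>M\<close> bounding \<open>int2 h\<close>, the \<open>m\<close>-th term of
  the series lies between 0 and \<open>M * (lam * M * t) ^ m / fact m\<close>, a multiple of a term
  of the exponential series; both claims follow by summation.\<close>

lemma resolvent_kernel_bounds:
  assumes h: "continuous_on {0..T} h" and h0: "\<And>t. t \<in> {0..T} \<Longrightarrow> 0 \<le> h t"
    and lam: "0 \<le> lam" and t: "t \<in> {0..T}"
  shows "0 \<le> resolvent_kernel h lam t"
    and "resolvent_kernel h lam t \<le> M_const T h * exp (lam * M_const T h * t)"
proof -
  let ?M = "M_const T h" and ?a = "\<lambda>m. lam ^ m * iterated_kernel (int2 h) m t"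
  have g: "continuous_on {0..T} (int2 h)" by (intro continuous_conv h continuous_intros)
  have nn: "0 \<le> ?a m" for m
    using iterated_kernel_nonneg[OF g int2_nonneg[OF h h0] t] lam by simp
  have "(\<lambda>m. ?M * ((lam * ?M * t) ^ m / fact m)) sums (?M * exp (lam * ?M * t))"
    using exp_converges[of "lam * ?M * t"] by (intro sums_mult) (simp add: divide_inverse mult.commute)
  moreover have le: "?a m \<le> ?M * ((lam * ?M * t) ^ m / fact m)" for m
  proof -
    have "?a m \<le> lam ^ m * (?M ^ Suc m / fact m * t ^ m)"
      using iterated_kernel_bound[OF g abs_int2_le_M_const[OF h] t, of m] lam
      by (intro mult_left_mono) auto
    then show ?thesis by (simp add: power_mult_distrib algebra_simps)
  qed
  ultimately have "summable ?a"
    using nn by (intro summable_comparison_test'[of "\<lambda>m. ?M * ((lam * ?M * t) ^ m / fact m)" 0 ?a])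
      (auto simp: sums_iff)
  then show "0 \<le> resolvent_kernel h lam t"
    and "resolvent_kernel h lam t \<le> ?M * exp (lam * ?M * t)"
    unfolding resolvent_kernel_def using nn le
      sums_le[OF le _ \<open>(\<lambda>m. ?M * ((lam * ?M * t) ^ m / fact m)) sums _\<close>]
    by (auto intro: suminf_nonneg summable_sums)
qed

text \<open>An estimate of Gronwall type: \<open>lam\<close> times the kernel bound integrates to
  exactly \<open>W * exp (lam * M * t) - W\<close>, and this \<open>- W\<close> absorbs the bound on
  \<open>w t\<close>, so no further constant appears before the exponential.\<close>

lemma resolvent_norm_bound:
  fixes w :: "real \<Rightarrow> 'b::banach"
  assumes h: "continuous_on {0..T} h" and h0: "\<And>t. t \<in> {0..T} \<Longrightarrow> 0 \<le> h t"
    and lam: "0 \<le> lam" and t: "t \<in> {0..T}"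
    and w: "continuous_on {0..T} w" and W: "\<And>t. t \<in> {0..T} \<Longrightarrow> norm (w t) \<le> W"
  shows "norm (w t + lam *\<^sub>R conv (resolvent_kernel h lam) w t) \<le> W * exp (lam * M_const T h * T)"
proof -
  let ?M = "M_const T h"
  have M: "0 \<le> ?M" using abs_int2_le_M_const[OF h t] by linarith
  have W0: "0 \<le> W" using W[OF t] norm_ge_zero order_trans by blast
  have "norm (conv (resolvent_kernel h lam) w t) \<le> integral {0..t} (\<lambda>s. ?M * exp (lam * ?M * (t - s)) * W)"
    unfolding conv_def
  proof (rule integral_norm_bound_integral[OF conv_integrable[OF resolvent_kernel_eq(1)[OF h] w t]])
    fix s assume s: "s \<in> {0..t}"
    then show "norm (resolvent_kernel h lam (t - s) *\<^sub>R w s) \<le> ?M * exp (lam * ?M * (t - s)) * W"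
      using resolvent_kernel_bounds[OF h h0 lam, of "t - s"] W[of s] t
      by (auto intro!: mult_mono)
  qed (intro integrable_continuous_interval continuous_intros)
  then have "lam * norm (conv (resolvent_kernel h lam) w t) \<le>
      integral {0..t} (\<lambda>s. lam * (?M * exp (lam * ?M * (t - s)) * W))"
    using lam by (simp add: mult_left_mono)
  \<comment> \<open>An antiderivative in \<open>s\<close> is
    \<open>- W * exp (lam * M * (t - s))\<close>. Differentiation produces the factor
    \<open>lam * M\<close>, so nothing is divided by it and the case \<open>lam * M = 0\<close> is
    covered.\<close>
  also have "((\<lambda>s. lam * (?M * exp (lam * ?M * (t - s)) * W)) has_integral
      (- W * exp (lam * ?M * (t - t))) - (- W * exp (lam * ?M * (t - 0)))) {0..t}"
    using t by (intro fundamental_theorem_of_calculus)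
      (auto intro!: derivative_eq_intros simp flip: has_real_derivative_iff_has_vector_derivative)
  then have "integral {0..t} (\<lambda>s. lam * (?M * exp (lam * ?M * (t - s)) * W)) = W * exp (lam * ?M * t) - W"
    by (subst integral_unique) auto
  finally have "lam * norm (conv (resolvent_kernel h lam) w t) \<le> W * exp (lam * ?M * t) - W" .
  moreover have "norm (w t + lam *\<^sub>R conv (resolvent_kernel h lam) w t) \<le>
      norm (w t) + lam * norm (conv (resolvent_kernel h lam) w t)"
    using norm_triangle_ineq[of "w t" "lam *\<^sub>R conv (resolvent_kernel h lam) w t"] lam by simp
  moreover have "W * exp (lam * ?M * t) \<le> W * exp (lam * ?M * T)"
    using t lam M W0 by (auto intro!: mult_left_mono)
  ultimately show ?thesis using W[OF t] by linarith
qed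

section \<open>Scalar Volterra equations and the condition at \<open>T\<close>\<close>

lemma volterra_solution_unique:
  fixes p w :: "real \<Rightarrow> 'k::euclidean_space"
  assumes h: "continuous_on {0..T} h" and p: "continuous_on {0..T} p"
    and eq: "\<And>t. t \<in> {0..T} \<Longrightarrow> p t = w t + lam *\<^sub>R conv (int2 h) p t" and t: "t \<in> {0..T}"
  shows "p t = w t + lam *\<^sub>R conv (resolvent_kernel h lam) w t"
proof -
  have w: "p s - lam *\<^sub>R conv (int2 h) p s = w s" if "s \<in> {0..T}" for s
    using eq[OF that] by simp
  have "conv (resolvent_kernel h lam) (\<lambda>s. p s - lam *\<^sub>R conv (int2 h) p s) t =
      conv (resolvent_kernel h lam) w t"
    by (rule conv_cong) (use w t in auto)
  \<comment> \<open>Here \<open>w = p - lam V p\<close>, and \<open>I + lam K\<close> is a left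
    inverse of \<open>I - lam V\<close>.\<close>
  then show ?thesis
    using resolvent_kernel_inverse(3)[OF h p t, of lam] w[OF t] by simp
qed

text \<open>The value at \<open>T\<close> is affine in \<open>c\<close>, with slope
  \<open>T + lam * conv k (\<lambda>s. s) T\<close>. This slope is positive because \<open>k\<close>
  is non-negative, so the condition can be solved for \<open>c\<close>. Existence uses one direction
  of the equivalence, uniqueness the other.\<close>

lemma resolvent_endpoint_iff:
  fixes F :: "real \<Rightarrow> 'k::{real_normed_field,euclidean_space}" and \<alpha> \<beta> c :: 'k
  assumes h: "continuous_on {0..T} h" and h0: "\<And>t. t \<in> {0..T} \<Longrightarrow> 0 \<le> h t"
    and lam: "0 \<le> lam" and T: "0 < T" and F: "continuous_on {0..T} F"
  defines "k \<equiv> resolvent_kernel h lam" and "w \<equiv> \<lambda>t. \<alpha> + t *\<^sub>R c + F t"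
  shows "w T + lam *\<^sub>R conv k w T = \<beta> \<longleftrightarrow>
    c = (\<beta> - \<alpha> - F T - of_real lam * conv k (\<lambda>s. \<alpha> + F s) T) / of_real (T + lam * conv k (\<lambda>s. s) T)"
proof -
  have k: "continuous_on {0..T} k" unfolding k_def by (rule resolvent_kernel_eq(1)[OF h])
  have TT: "T \<in> {0..T}" using T by auto
  have "0 \<le> conv k (\<lambda>s. s) T"
    unfolding conv_def
  proof (rule integral_nonneg[OF conv_integrable[OF k _ TT]])
    fix s assume "s \<in> {0..T}"
    then show "0 \<le> k (T - s) *\<^sub>R s"
      unfolding k_def using resolvent_kernel_bounds(1)[OF h h0 lam, of "T - s"] by auto
  qed (intro continuous_intros)
  then have "0 < T + lam * conv k (\<lambda>s. s) T" using T lam by (simp add: add_pos_nonneg)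
  then have nz: "of_real (T + lam * conv k (\<lambda>s. s) T) \<noteq> (0::'k)"
    unfolding of_real_eq_0_iff by linarith
  have "w = (\<lambda>s. (\<alpha> + F s) + s *\<^sub>R c)" by (auto simp: w_def)
  moreover have "conv k (\<lambda>s. (\<alpha> + F s) + s *\<^sub>R c) T = conv k (\<lambda>s. \<alpha> + F s) T + conv k (\<lambda>s. s *\<^sub>R c) T"
    by (rule conv_add[OF k _ _ TT]) (intro continuous_intros F)+
  moreover have "conv k (\<lambda>s. s *\<^sub>R c) T = conv k (\<lambda>s. s) T *\<^sub>R c"
    by (rule conv_bounded_linear[OF bounded_linear_scaleR_left k _ TT]) (intro continuous_intros)
  ultimately have "w T + lam *\<^sub>R conv k w T = \<alpha> + F T + of_real lam * conv k (\<lambda>s. \<alpha> + F s) T +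
      c * of_real (T + lam * conv k (\<lambda>s. s) T)"
    by (simp add: scaleR_conv_of_real algebra_simps)
  then show ?thesis
    unfolding nonzero_eq_divide_eq[OF nz] by (auto simp: algebra_simps)
qed

section \<open>Orthonormal expansions\<close>

lemma scalar_conj_add: "scalar_conj (x + y) = scalar_conj x + scalar_conj y"
  by (simp add: scalar_conj_def inner_add_left algebra_simps)

lemma scalar_conj_of_real_mult: "scalar_conj (of_real r * x) = of_real r * scalar_conj x"
proof -
  have "(of_real r * x) \<bullet> 1 = r * (x \<bullet> 1)"
    by (metis inner_scaleR_left scaleR_conv_of_real)
  then show ?thesis by (simp add: scalar_conj_def algebra_simps)
qed

lemma scalar_conj_of_real: "scalar_conj (of_real r) = (of_real r :: 'k::{real_normed_field,euclidean_space})"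
proof -
  have "(of_real r :: 'k) \<bullet> 1 = r"
    by (simp add: of_real_def flip: power2_norm_eq_inner)
  then show ?thesis by (simp add: scalar_conj_def)
qed

text \<open>Conjugation is the reflection that fixes the line through 1 and negates its orthogonal
  complement; since 1 is a unit vector, it is an isometry.\<close>

lemma norm_scalar_conj: "norm (scalar_conj x) = norm (x :: 'k::{real_normed_field,euclidean_space})"
proof -
  have "(1::'k) \<bullet> 1 = 1" by (simp flip: power2_norm_eq_inner)
  moreover have "scalar_conj x = (2 * (x \<bullet> 1)) *\<^sub>R 1 - x"
    by (simp add: scalar_conj_def of_real_def)
  ultimately have "scalar_conj x \<bullet> scalar_conj x = x \<bullet> x"
    by (simp add: inner_diff_left inner_diff_right inner_commute[of 1 x])
  then show ?thesis by (simp add: norm_eq_sqrt_inner)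
qed

context hilbert_space
begin

section \<open>Sesquilinearity and the Cauchy-Schwarz inequality\<close>

lemma ip_of_real_right: "ip x (r *\<^sub>R y) = of_real r * ip x y"
  unfolding scale_of_real[symmetric]
  by (subst ip_commute) (simp add: ip_scale_left scalar_conj_of_real_mult ip_commute[of x y, symmetric])

lemma ip_of_real_left: "ip (r *\<^sub>R x) y = of_real r * ip x y"
  unfolding scale_of_real[symmetric] by (rule ip_scale_left)

lemma ip_add_right: "ip x (y + z) = ip x y + ip x z"
  by (metis ip_commute ip_add_left scalar_conj_add)

lemma ip_eq_0_commute: "ip x y = 0 \<longleftrightarrow> ip y x = 0"
  by (metis ip_commute scalar_conj_of_real of_real_0)

text \<open>The identity is read off from the scalar product: expanding
  \<open>ip (smul a x) (smul a x)\<close> and dividing by the square of \<open>norm x\<close> shows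
  that \<open>a * scalar_conj a\<close> is a non-negative real. Taking norms then identifies this
  real.\<close>

lemma mult_scalar_conj:
  assumes "(x :: 'h) \<noteq> 0"
  shows "a * scalar_conj a = of_real ((norm (a :: 'k))\<^sup>2)"
proof -
  have n: "norm x \<noteq> 0" using assms by simp
  have "of_real ((norm (smul a x))\<^sup>2) = a * scalar_conj (of_real ((norm x)\<^sup>2) * a)"
    by (metis ip_self ip_scale_left ip_commute mult.commute)
  also have "\<dots> = of_real ((norm x)\<^sup>2) * (a * scalar_conj a)"
    by (simp add: scalar_conj_of_real_mult del: of_real_power)
  finally have "a * scalar_conj a = of_real ((norm (smul a x))\<^sup>2 / (norm x)\<^sup>2)"
    using n by (simp add: field_simps)
  moreover from this have "norm (a * scalar_conj a) = (norm (smul a x))\<^sup>2 / (norm x)\<^sup>2"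
    by (simp only: norm_of_real) simp
  then have "(norm a)\<^sup>2 = (norm (smul a x))\<^sup>2 / (norm x)\<^sup>2"
    by (simp add: norm_mult norm_scalar_conj power2_eq_square)
  ultimately show ?thesis by simp
qed

lemma norm_smul: "norm (smul a x) = norm a * norm x"
proof (cases "x = 0")
  case False
  have "of_real ((norm (smul a x))\<^sup>2) = a * scalar_conj (of_real ((norm x)\<^sup>2) * a)"
    by (metis ip_self ip_scale_left ip_commute mult.commute)
  also have "\<dots> = of_real ((norm x)\<^sup>2) * (a * scalar_conj a)"
    by (simp add: scalar_conj_of_real_mult del: of_real_power)
  also have "\<dots> = of_real ((norm a * norm x)\<^sup>2)"
    by (simp add: mult_scalar_conj[OF False] power_mult_distrib)
  finally have "(norm (smul a x))\<^sup>2 = (norm a * norm x)\<^sup>2"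
    unfolding of_real_eq_iff .
  then show ?thesis by simp
qed simp

text \<open>The triangle inequality comes with the norm, so the usual derivation is reversed: expand
  the square of \<open>norm (x + y)\<close> and compare with the square of
  \<open>norm x + norm y\<close>.\<close>

lemma real_part_ip_le: "ip x y \<bullet> 1 \<le> norm x * norm y"
proof -
  have r: "of_real r \<bullet> (1::'k) = r" for r
    by (simp add: of_real_def flip: power2_norm_eq_inner)
  have "ip (x + y) (x + y) = of_real ((norm x)\<^sup>2) + (ip x y + scalar_conj (ip x y)) + of_real ((norm y)\<^sup>2)"
    by (simp add: ip_add_left ip_add_right ip_self[of x] ip_self[of y] ip_commute[of y x] del: of_real_power)
  also have "\<dots> = of_real ((norm x)\<^sup>2 + 2 * (ip x y \<bullet> 1) + (norm y)\<^sup>2)"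
    by (simp add: scalar_conj_def)
  finally have "(norm (x + y))\<^sup>2 = (norm x)\<^sup>2 + 2 * (ip x y \<bullet> 1) + (norm y)\<^sup>2"
    unfolding ip_self of_real_eq_iff .
  moreover have "(norm (x + y))\<^sup>2 \<le> (norm x + norm y)\<^sup>2"
    by (intro power_mono norm_triangle_ineq) simp
  ultimately show ?thesis by (simp add: power2_sum)
qed

lemma norm_ip_le: "norm (ip x y) \<le> norm x * norm y"
proof (cases "ip x y = 0")
  case False
  then have "x \<noteq> 0" by (metis ip_scale_left mult_zero_left scale_zero_left)
  \<comment> \<open>Multiplying \<open>x\<close> by the conjugate of \<open>ip x y\<close> makes the
    product real, which reduces the claim to the bound on real parts; one factor
    \<open>norm a\<close> is then cancelled.\<close>
  define a where "a = scalar_conj (ip x y)"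
  have na: "norm a = norm (ip x y)" by (simp add: a_def norm_scalar_conj)
  have "a * ip x y = of_real ((norm a)\<^sup>2)"
    using mult_scalar_conj[OF \<open>x \<noteq> 0\<close>, of "ip x y"] by (simp add: a_def norm_scalar_conj mult.commute)
  then have "ip (smul a x) y \<bullet> 1 = (norm a)\<^sup>2"
    by (simp add: ip_scale_left of_real_def flip: power2_norm_eq_inner)
  with real_part_ip_le[of "smul a x" y] have "norm a * norm a \<le> norm a * (norm x * norm y)"
    by (simp add: norm_smul power2_eq_square mult.assoc)
  then show ?thesis using False na by (simp add: mult_le_cancel_left)
qed simp

lemma bounded_linear_ip_left: "bounded_linear (\<lambda>x. ip x y)"
  by (rule bounded_linear_intro[where K="norm y"])
    (simp_all add: ip_add_left ip_of_real_left scaleR_conv_of_real norm_ip_le)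

lemma bounded_linear_ip_right: "bounded_linear (\<lambda>y. ip x y)"
  by (rule bounded_linear_intro[where K="norm x"])
    (simp_all add: ip_add_right ip_of_real_right scaleR_conv_of_real norm_ip_le mult.commute[of _ "norm x"])

lemma ip_diff_left: "ip (x - y) z = ip x z - ip y z"
  by (rule linear_diff[OF bounded_linear.linear[OF bounded_linear_ip_left]])

lemma ip_diff_right: "ip x (y - z) = ip x y - ip x z"
  by (rule linear_diff[OF bounded_linear.linear[OF bounded_linear_ip_right]])

lemma ip_sum_left: "ip (sum x I) y = (\<Sum>j\<in>I. ip (x j) y)"
  by (rule linear_sum[OF bounded_linear.linear[OF bounded_linear_ip_left]])

section \<open>Dense sets, coefficients and orthonormal series\<close>

lemma eq_0_if_ip_dense_eq_0:
  assumes "closure D = UNIV" "\<And>x. x \<in> D \<Longrightarrow> ip x y = 0"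
  shows "y = 0"
proof -
  have "closed {x. ip x y = 0}"
    by (intro closed_Collect_eq continuous_intros linear_continuous_on bounded_linear_ip_left)
  then have "closure D \<subseteq> {x. ip x y = 0}"
    by (intro closure_minimal) (use assms in auto)
  then have "ip y y = 0" using assms(1) by auto
  then show ?thesis by (simp add: ip_self)
qed

lemma orthonormal_basis_eqI:
  assumes "orthonormal_basis smul ip \<phi>" and eq: "\<And>j. ip x (\<phi> j) = ip y (\<phi> j)"
  shows "x = y"
proof -
  have "subspace {z. ip z (x - y) = 0}"
    by (rule subspaceI) (simp_all add: ip_add_left ip_scale_left
        linear_0[OF bounded_linear.linear[OF bounded_linear_ip_left]])
  \<comment> \<open>The span is closed under scalars in the first slot, where the product is linear;
    the hypothesis has \<phi> in the second slot, so the orthogonality is flipped.\<close>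
  moreover have "ip (\<phi> j) (x - y) = 0" for j
    by (subst ip_eq_0_commute) (simp add: ip_diff_left eq)
  ultimately have "span (range \<phi>) \<subseteq> {z. ip z (x - y) = 0}"
    by (intro span_minimal) auto
  then have "x - y = 0"
    using assms(1) by (intro eq_0_if_ip_dense_eq_0) (auto simp: orthonormal_basis_def)
  then show ?thesis by simp
qed

lemma norm_orthonormal_sum:
  assumes \<phi>: "orthonormal_basis smul ip \<phi>" and I: "finite I"
  shows "(norm (\<Sum>j\<in>I. smul (a j) (\<phi> j)))\<^sup>2 = (\<Sum>j\<in>I. (norm (a j))\<^sup>2)"
proof -
  let ?S = "\<Sum>j\<in>I. smul (a j) (\<phi> j)"
  have on: "ip (\<phi> i) (\<phi> j) = (if i = j then 1 else 0)" for i j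
    using \<phi> by (simp add: orthonormal_basis_def)
  \<comment> \<open>\<open>mult_scalar_conj\<close> needs some nonzero vector of the space; a basis
    vector is at hand.\<close>
  have nz: "\<phi> 0 \<noteq> 0" using on[of 0 0] by (metis ip_self norm_zero of_real_0 power_zero_numeral zero_neq_one)
  have S: "ip ?S (\<phi> j) = a j" if "j \<in> I" for j
    using that I by (simp add: ip_sum_left ip_scale_left on if_distrib cong: if_cong)
  have "ip ?S ?S = (\<Sum>j\<in>I. a j * ip (\<phi> j) ?S)"
    unfolding ip_sum_left[of _ I ?S] by (simp only: ip_scale_left)
  also have "\<dots> = (\<Sum>j\<in>I. a j * scalar_conj (ip ?S (\<phi> j)))"
    by (simp only: ip_commute[of _ ?S])
  also have "\<dots> = (\<Sum>j\<in>I. of_real ((norm (a j))\<^sup>2))"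
    by (intro sum.cong) (simp_all only: S mult_scalar_conj[OF nz])
  finally show ?thesis
    unfolding ip_self of_real_sum[symmetric] of_real_eq_iff .
qed

text \<open>A Riesz-Fischer theorem with a parameter: by Pythagoras the square of the norm of a
  block of the series is at most the corresponding block of \<open>B\<close>, independently of
  \<open>t\<close>, and the space is complete.\<close>

lemma uniform_orthonormal_series:
  assumes \<phi>: "orthonormal_basis smul ip \<phi>"
    and le: "\<And>j t. t \<in> S \<Longrightarrow> (norm (a j t))\<^sup>2 \<le> B j" and B: "summable B"
  obtains g where "uniform_limit S (\<lambda>n t. \<Sum>j<n. smul (a j t) (\<phi> j)) g sequentially"
    and "\<And>j t. t \<in> S \<Longrightarrow> ip (g t) (\<phi> j) = a j t"
proof -
  have "uniformly_Cauchy_on S (\<lambda>n t. \<Sum>j<n. smul (a j t) (\<phi> j))"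
  proof (rule uniformly_Cauchy_onI')
    fix e :: real assume e: "0 < e"
    then obtain N where N: "\<And>m n. N \<le> m \<Longrightarrow> norm (sum B {m..<n}) < e\<^sup>2"
      using B unfolding summable_Cauchy by (metis zero_less_power)
    have "dist (\<Sum>j<m. smul (a j t) (\<phi> j)) (\<Sum>j<n. smul (a j t) (\<phi> j)) < e"
      if t: "t \<in> S" and m: "N \<le> m" and mn: "m < n" for t m n
    proof -
      have "dist (\<Sum>j<m. smul (a j t) (\<phi> j)) (\<Sum>j<n. smul (a j t) (\<phi> j)) =
          norm (\<Sum>j=m..<n. smul (a j t) (\<phi> j))"
        by (subst dist_commute) (use mn in \<open>simp add: dist_norm sum_diff_nat_ivl lessThan_atLeast0\<close>)
      moreover have "(norm (\<Sum>j=m..<n. smul (a j t) (\<phi> j)))\<^sup>2 \<le> sum B {m..<n}"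
        by (subst norm_orthonormal_sum[OF \<phi>]) (auto intro!: sum_mono le t)
      ultimately show ?thesis
        using N[OF m, of n] e by (intro power2_less_imp_less[of _ e]) auto
    qed
    then show "\<exists>N. \<forall>t\<in>S. \<forall>m\<ge>N. \<forall>n>m.
        dist (\<Sum>j<m. smul (a j t) (\<phi> j)) (\<Sum>j<n. smul (a j t) (\<phi> j)) < e"
      by blast
  qed
  then obtain g where g: "uniform_limit S (\<lambda>n t. \<Sum>j<n. smul (a j t) (\<phi> j)) g sequentially"
    using Cauchy_uniformly_convergent unfolding uniformly_convergent_on_def by blast
  moreover have "ip (g t) (\<phi> j) = a j t" if t: "t \<in> S" for j t
  proof -
    have "(\<lambda>n. \<Sum>i<n. smul (a i t) (\<phi> i)) \<longlonglongrightarrow> g t"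
      by (rule tendsto_uniform_limitI[OF g t])
    then have lim: "(\<lambda>n. ip (\<Sum>i<n. smul (a i t) (\<phi> i)) (\<phi> j)) \<longlonglongrightarrow> ip (g t) (\<phi> j)"
      by (rule bounded_linear.tendsto[OF bounded_linear_ip_left])
    \<comment> \<open>Once \<open>n > j\<close>, the \<open>j\<close>-th coefficient of the partial
      sum no longer changes.\<close>
    have "\<forall>\<^sub>F n in sequentially. ip (\<Sum>i<n. smul (a i t) (\<phi> i)) (\<phi> j) = a j t"
      using eventually_gt_at_top[of j]
    proof eventually_elim
      case (elim n)
      have on: "ip (\<phi> i) (\<phi> j) = (if i = j then 1 else 0)" for i
        using \<phi> by (simp add: orthonormal_basis_def)
      show ?case
        using elim by (simp add: ip_sum_left ip_scale_left on if_distrib cong: if_cong)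
    qed
    from LIMSEQ_unique[OF lim tendsto_eventually[OF this]] show ?thesis .
  qed
  ultimately show ?thesis by (rule that)
qed

section \<open>Selfadjoint operators\<close>

text \<open>Such a \<open>y\<close> lies in the domain of the adjoint, which is \<open>D\<close>.
  Density of \<open>D\<close> makes \<open>z\<close> unique, so the definite description in
  \<open>adjoint_map\<close> picks it.\<close>

lemma selfadjoint_memI:
  assumes A: "selfadjoint smul ip D A" and y: "\<And>x. x \<in> D \<Longrightarrow> ip (A x) y = ip x z"
  shows "y \<in> D" and "A y = z"
proof -
  have D: "closure D = UNIV" and dom: "adjoint_domain ip D A = D" 
    and adj: "\<And>y. y \<in> D \<Longrightarrow> adjoint_map ip D A y = A y"
    using A by (auto simp: selfadjoint_def)
  have "y \<in> adjoint_domain ip D A" unfolding adjoint_domain_def using y by blast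
  then show "y \<in> D" by (simp only: dom)
  have "adjoint_map ip D A y = z"
    unfolding adjoint_map_def
  proof (rule the_equality)
    show "\<forall>x\<in>D. ip (A x) y = ip x z" using y by blast
    fix z' assume z': "\<forall>x\<in>D. ip (A x) y = ip x z'"
    have "z' - z = 0"
      by (rule eq_0_if_ip_dense_eq_0[OF D])
        (use y z' in \<open>auto simp: ip_diff_right\<close>)
    then show "z' = z" by simp
  qed
  with adj[OF \<open>y \<in> D\<close>] show "A y = z" by simp
qed

lemma selfadjoint_symmetric:
  assumes A: "selfadjoint smul ip D A" and x: "x \<in> D" and y: "y \<in> D"
  shows "ip (A x) y = ip x (A y)"
proof -
  obtain z where "\<forall>x\<in>D. ip (A x) y = ip x z"
    using A y unfolding selfadjoint_def adjoint_domain_def by blast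
  then show ?thesis using selfadjoint_memI(2)[OF A, of y z] x by auto
qed

text \<open>An adjoint is closed: pass to the limit in
  \<open>ip (A w) (x n) = ip w (A (x n))\<close> for fixed \<open>w\<close> in
  \<open>D\<close>.\<close>

lemma selfadjoint_closed:
  assumes A: "selfadjoint smul ip D A" and x: "\<And>n. x n \<in> D"
    and lim: "x \<longlonglongrightarrow> y" "(\<lambda>n. A (x n)) \<longlonglongrightarrow> z"
  shows "y \<in> D" and "A y = z"
proof -
  have "ip (A w) y = ip w z" if w: "w \<in> D" for w
  proof -
    have "(\<lambda>n. ip (A w) (x n)) \<longlonglongrightarrow> ip (A w) y" "(\<lambda>n. ip w (A (x n))) \<longlonglongrightarrow> ip w z"
      by (intro bounded_linear.tendsto[OF bounded_linear_ip_right] lim)+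
    then show ?thesis
      by (simp only: selfadjoint_symmetric[OF A w x]) (rule LIMSEQ_unique)
  qed
  then show "y \<in> D" "A y = z" using selfadjoint_memI[OF A] by blast+
qed

text \<open>The eigenvalue is attached to the coefficient, so that the image is again a partial sum
  of the form treated in \<open>uniform_orthonormal_series\<close>.\<close>

lemma eigenvector_sum:
  assumes A: "linear_operator smul D A" and \<phi>: "\<And>j. \<phi> j \<in> D" "\<And>j. A (\<phi> j) = lam j *\<^sub>R \<phi> j"
  shows "(\<Sum>j<n::nat. smul (a j) (\<phi> j)) \<in> D"
    and "A (\<Sum>j<n. smul (a j) (\<phi> j)) = (\<Sum>j<n. smul (lam j *\<^sub>R a j) (\<phi> j))"
proof -
  have D: "subspace D" and add: "\<And>x y. x \<in> D \<Longrightarrow> y \<in> D \<Longrightarrow> A (x + y) = A x + A y"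
    and scale: "\<And>c x. x \<in> D \<Longrightarrow> A (smul c x) = smul c (A x)"
    using A by (auto simp: linear_operator_def)
  show mem: "(\<Sum>j<n. smul (a j) (\<phi> j)) \<in> D" for n
    by (intro subspace_sum[OF D] subspace_scale[OF D] \<phi>)
  have "A 0 = 0" using scale[OF subspace_0[OF D], of 0] by simp
  moreover have "A (smul (a j) (\<phi> j)) = smul (lam j *\<^sub>R a j) (\<phi> j)" for j
    by (simp add: scale \<phi> scaleR_conv_of_real mult.commute flip: scale_of_real)
  ultimately show "A (\<Sum>j<n. smul (a j) (\<phi> j)) = (\<Sum>j<n. smul (lam j *\<^sub>R a j) (\<phi> j))"
    by (induction n) (simp_all add: add mem subspace_scale[OF D] \<phi>)
qed

lemma linear_operator_diff:
  assumes A: "linear_operator smul D A" and x: "x \<in> D" and y: "y \<in> D"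
  shows "A (x - y) = A x - A y"
proof -
  have D: "subspace D" using A by (simp add: linear_operator_def)
  have "A (x - y + y) = A (x - y) + A y"
    using A subspace_diff[OF D x y] y unfolding linear_operator_def by blast
  then show ?thesis by simp
qed

lemma continuous_graph_norm_iff:
  assumes A: "linear_operator smul D A"
  shows "continuous_graph_norm I D A u \<longleftrightarrow>
    (\<forall>t\<in>I. u t \<in> D) \<and> continuous_on I u \<and> continuous_on I (\<lambda>t. A (u t))"
proof (cases "\<forall>t\<in>I. u t \<in> D")
  case True
  have *: "((\<lambda>s. graph_norm A (u s - u t)) \<longlongrightarrow> 0) (at t within I) \<longleftrightarrow>
      (u \<longlongrightarrow> u t) (at t within I) \<and> ((\<lambda>s. A (u s)) \<longlongrightarrow> A (u t)) (at t within I)"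
    if t: "t \<in> I" for t
  proof -
    \<comment> \<open>Only points of \<open>I\<close> matter in this limit; there \<open>u s\<close>
      and \<open>u t\<close> lie in \<open>D\<close>, so \<open>A\<close> may be distributed over
      the difference.\<close>
    have ev: "\<forall>\<^sub>F s in at t within I. s \<in> I" by (simp add: eventually_at_filter)
    have "((\<lambda>s. graph_norm A (u s - u t)) \<longlongrightarrow> 0) (at t within I) \<longleftrightarrow>
        ((\<lambda>s. norm (u s - u t) + norm (A (u s) - A (u t))) \<longlongrightarrow> 0) (at t within I)"
      by (intro tendsto_cong eventually_mono[OF ev])
        (use True t linear_operator_diff[OF A] in \<open>auto simp: graph_norm_def\<close>)
    also have "\<dots> \<longleftrightarrow> ((\<lambda>s. norm (u s - u t)) \<longlongrightarrow> 0) (at t within I) \<and>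
        ((\<lambda>s. norm (A (u s) - A (u t))) \<longlongrightarrow> 0) (at t within I)"
    proof (intro iffI conjI)
      assume "((\<lambda>s. norm (u s - u t) + norm (A (u s) - A (u t))) \<longlongrightarrow> 0) (at t within I)"
      from tendsto_sandwich[OF _ _ tendsto_const this]
      show "((\<lambda>s. norm (u s - u t)) \<longlongrightarrow> 0) (at t within I)"
        "((\<lambda>s. norm (A (u s) - A (u t))) \<longlongrightarrow> 0) (at t within I)"
        by (auto intro!: always_eventually)
    qed (auto intro: tendsto_add_zero)
    finally show ?thesis
      by (simp add: tendsto_norm_zero_iff flip: LIM_zero_iff[of u] LIM_zero_iff[of "\<lambda>s. A (u s)"])
  qed
  show ?thesis
    using True * by (auto simp: continuous_graph_norm_def continuous_on_def)
qed (auto simp: continuous_graph_norm_def)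

text \<open>Common to both halves of the proof: \<open>a\<close> stands for \<open>A v\<close> with
  a given solution \<open>v\<close> in the uniqueness part, and for the limit of the series of
  \<open>A u\<close> in the existence part.\<close>

lemma ip_int2_conv:
  assumes h: "continuous_on {0..T} h" and a: "continuous_on {0..T} a" and f: "continuous_on {0..T} f"
    and p: "continuous_on {0..T} p" and ap: "\<And>s. s \<in> {0..T} \<Longrightarrow> ip (a s) \<psi> = lam *\<^sub>R p s" and t: "t \<in> {0..T}"
  shows "ip (x + t *\<^sub>R c + int2 (\<lambda>s. conv h a s + f s) t) \<psi> =
    (ip x \<psi> + t *\<^sub>R ip c \<psi> + f_tilde ip \<psi> f t) + lam *\<^sub>R conv (int2 h) p t"
proof -
  have id: "continuous_on {0..T} (\<lambda>t. t)" by (intro continuous_intros)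
  have cf: "continuous_on {0..T} (\<lambda>s. ip (f s) \<psi>)"
    by (rule continuous_on_compose2[OF linear_continuous_on[OF bounded_linear_ip_left, of UNIV] f]) auto
  have ha: "ip (conv h a s) \<psi> = lam *\<^sub>R conv h p s" if s: "s \<in> {0..T}" for s
  proof -
    have "ip (conv h a s) \<psi> = conv h (\<lambda>s. ip (a s) \<psi>) s"
      by (rule conv_bounded_linear[OF bounded_linear_ip_left h a s, symmetric])
    also have "\<dots> = conv h (\<lambda>s. lam *\<^sub>R p s) s"
      by (rule conv_cong) (use ap s in auto)
    also have "\<dots> = lam *\<^sub>R conv h p s"
      by (rule conv_bounded_linear[OF bounded_linear_scaleR_right h p s])
    finally show ?thesis .
  qed
  have "ip (int2 (\<lambda>s. conv h a s + f s) t) \<psi> = int2 (\<lambda>s. ip (conv h a s + f s) \<psi>) t"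
    by (rule conv_bounded_linear[OF bounded_linear_ip_left id _ t, symmetric])
      (intro continuous_on_add continuous_conv h a f)
  also have "\<dots> = int2 (\<lambda>s. ip (f s) \<psi> + lam *\<^sub>R conv h p s) t"
    by (rule conv_cong) (use ha t in \<open>auto simp: ip_add_left\<close>)
  also have "\<dots> = f_tilde ip \<psi> f t + lam *\<^sub>R int2 (conv h p) t"
    unfolding f_tilde_def by (rule conv_add_scale(1)[OF id id cf continuous_conv[OF h p] t])
  \<comment> \<open>\<open>int2\<close> is convolution with the identity function, so associativity
    moves the double integration onto the kernel.\<close>
  also have "int2 (conv h p) t = conv (int2 h) p t"
    by (rule conv_assoc[OF id h p t])
  finally show ?thesis
    by (simp add: ip_add_left ip_of_real_left scaleR_conv_of_real)
qed

end

section \<open>The boundary value problem\<close>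

locale volterra_problem = hilbert_space smul ip
  for smul :: "'k::{real_normed_field,euclidean_space} \<Rightarrow> 'h::banach \<Rightarrow> 'h"
    and ip :: "'h \<Rightarrow> 'h \<Rightarrow> 'k" +
  fixes D :: "'h set" and A :: "'h \<Rightarrow> 'h"
    and \<phi> :: "nat \<Rightarrow> 'h" and lam :: "nat \<Rightarrow> real"
    and T :: real and h :: "real \<Rightarrow> real" and f :: "real \<Rightarrow> 'h" and u0 u2 :: 'h
  assumes A: "selfadjoint smul ip D A"
    and \<phi>: "orthonormal_basis smul ip \<phi>"
    and \<phi>_mem: "\<And>j. \<phi> j \<in> D" and A_\<phi>: "\<And>j. A (\<phi> j) = lam j *\<^sub>R \<phi> j"
    and lam_pos: "\<And>j. lam j > 0"
    and T: "T > 0"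
    and f: "continuous_on {0..T} f"
    and h: "continuous_on {0..T} h" and h_nonneg: "\<And>t. t \<in> {0..T} \<Longrightarrow> h t \<ge> 0"
begin

section \<open>Fourier coefficients of the solution\<close>

definition coef_data :: "nat \<Rightarrow> real \<Rightarrow> 'k" where
  "coef_data j t = ip u0 (\<phi> j) + t *\<^sub>R c_coef ip T h f u0 u2 (lam j) (\<phi> j) + f_tilde ip (\<phi> j) f t"

text \<open>This is \<open>I + lam K\<close> applied to the free term \<open>coef_data\<close>, in
  which the slope is already the value \<open>c_coef\<close> prescribed by the condition at
  \<open>T\<close>.\<close>

definition coef :: "nat \<Rightarrow> real \<Rightarrow> 'k" where
  "coef j t = coef_data j t + lam j *\<^sub>R conv (resolvent_kernel h (lam j)) (coef_data j) t"

lemma continuous_f_tilde: "continuous_on {0..T} (f_tilde ip \<psi> f)"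
  unfolding f_tilde_def
  by (intro continuous_conv continuous_intros
      continuous_on_compose2[OF linear_continuous_on[OF bounded_linear_ip_left, of UNIV] f]) auto

lemma continuous_coef_data: "continuous_on {0..T} (coef_data j)"
  unfolding coef_data_def[abs_def] by (intro continuous_intros continuous_f_tilde)

lemma continuous_coef: "continuous_on {0..T} (coef j)"
  unfolding coef_def[abs_def]
  by (intro continuous_intros continuous_conv continuous_coef_data resolvent_kernel_eq(1)[OF h])

lemma coef_volterra:
  assumes "t \<in> {0..T}"
  shows "coef j t = coef_data j t + lam j *\<^sub>R conv (int2 h) (coef j) t"
  using resolvent_kernel_inverse(2)[where lam = "lam j", OF h continuous_coef_data[of j] assms]
  unfolding coef_def[abs_def] by (simp add: algebra_simps)

lemma coef_T: "coef j T = ip u2 (\<phi> j)"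
  unfolding coef_def coef_data_def[abs_def]
  by (subst resolvent_endpoint_iff[OF h h_nonneg less_imp_le[OF lam_pos] T continuous_f_tilde])
    (auto simp: c_coef_def Let_def)

lemma ip_solution:
  assumes v: "is_solution T D A h f u0 u2 v" and t: "t \<in> {0..T}"
  shows "ip (v t) (\<phi> j) = coef j t"
proof -
  obtain v' v'' where C2: "C2_on_with {0..T} v v' v''"
    and v'': "\<And>t. t \<in> {0..T} \<Longrightarrow> v'' t = conv h (\<lambda>s. A (v s)) t + f t"
    and gr: "continuous_graph_norm {0..T} D A v" and bc: "v 0 = u0" "v T = u2"
    using v unfolding is_solution_def by blast
  have mem: "v t \<in> D" if "t \<in> {0..T}" for t using gr that by (simp add: continuous_graph_norm_def)
  have cv: "continuous_on {0..T} v" and cA: "continuous_on {0..T} (\<lambda>t. A (v t))"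
    using gr A unfolding selfadjoint_def by (simp_all add: continuous_graph_norm_iff)
  define p where "p = (\<lambda>t. ip (v t) (\<phi> j))"
  have p: "continuous_on {0..T} p"
    unfolding p_def
    by (rule continuous_on_compose2[OF linear_continuous_on[OF bounded_linear_ip_left, of UNIV] cv]) auto
  \<comment> \<open>Symmetry moves \<open>A\<close> onto the eigenvector; \<open>lam j\<close> is
    real and leaves the second slot without conjugation.\<close>
  have Ap: "ip (A (v s)) (\<phi> j) = lam j *\<^sub>R p s" if "s \<in> {0..T}" for s
    by (simp add: selfadjoint_symmetric[OF A mem[OF that] \<phi>_mem] A_\<phi> ip_of_real_right p_def scaleR_conv_of_real)
  define w where "w = (\<lambda>t. ip u0 (\<phi> j) + t *\<^sub>R ip (v' 0) (\<phi> j) + f_tilde ip (\<phi> j) f t)"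
  have "p t = w t + lam j *\<^sub>R conv (int2 h) p t" if t: "t \<in> {0..T}" for t
  proof -
    have "v t = u0 + t *\<^sub>R v' 0 + int2 v'' t"
      using C2_on_with_taylor[OF C2 t] bc by simp
    also have "int2 v'' t = int2 (\<lambda>s. conv h (\<lambda>s. A (v s)) s + f s) t"
      by (rule conv_cong) (use v'' t in auto)
    finally show ?thesis
      unfolding p_def w_def using ip_int2_conv[OF h cA f p Ap t] by (simp add: p_def)
  qed
  then have pw: "p t = w t + lam j *\<^sub>R conv (resolvent_kernel h (lam j)) w t" if "t \<in> {0..T}" for t
    using volterra_solution_unique[OF h p _ that, of w "lam j"] by blast
  then have "w T + lam j *\<^sub>R conv (resolvent_kernel h (lam j)) w T = ip u2 (\<phi> j)"
    using T bc pw[of T] by (simp add: p_def)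
  \<comment> \<open>The value at \<open>T\<close> forces the coefficient of the unknown slope
    \<open>v' 0\<close>; from here on \<open>w\<close> depends on the data alone.\<close>
  then have "ip (v' 0) (\<phi> j) = c_coef ip T h f u0 u2 (lam j) (\<phi> j)"
    unfolding w_def
    by (subst (asm) resolvent_endpoint_iff[OF h h_nonneg less_imp_le[OF lam_pos] T continuous_f_tilde])
      (auto simp: c_coef_def Let_def)
  then have "w = coef_data j" by (simp add: w_def coef_data_def[abs_def])
  with pw[OF t] show ?thesis by (simp add: coef_def p_def)
qed

section \<open>Growth of the coefficients\<close>

lemma L_coef_ge:
  assumes s: "s \<in> {0..T}"
  shows "(norm (ip u0 (\<phi> j)))\<^sup>2 + T\<^sup>2 * (norm (c_coef ip T h f u0 u2 (lam j) (\<phi> j)))\<^sup>2 +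
    (norm (f_tilde ip (\<phi> j) f s))\<^sup>2 \<le> L_coef ip T h f u0 u2 (lam j) (\<phi> j)"
proof -
  \<comment> \<open>Continuity on a compact interval bounds the set of values above, as is required
    for its supremum to dominate each value.\<close>
  have "compact ((\<lambda>t. (norm (f_tilde ip (\<phi> j) f t))\<^sup>2) ` {0..T})"
    by (intro compact_continuous_image continuous_intros continuous_f_tilde) simp
  then have "bdd_above ((\<lambda>t. (norm (f_tilde ip (\<phi> j) f t))\<^sup>2) ` {0..T})"
    by (simp add: bounded_imp_bdd_above compact_imp_bounded)
  from cSUP_upper[OF s this] show ?thesis by (simp add: L_coef_def)
qed

text \<open>The factor 3 comes from squaring the three-term sum \<open>coef_data\<close>; squaring
  the resolvent bound doubles the exponent.\<close>

lemma norm_coef_le: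
  assumes t: "t \<in> {0..T}"
  shows "(norm (coef j t))\<^sup>2 \<le>
    3 * (L_coef ip T h f u0 u2 (lam j) (\<phi> j) * exp (2 * lam j * M_const T h * T))"
proof -
  let ?c = "c_coef ip T h f u0 u2 (lam j) (\<phi> j)" and ?L = "L_coef ip T h f u0 u2 (lam j) (\<phi> j)"
  have w: "norm (coef_data j s) \<le> sqrt (3 * ?L)" if s: "s \<in> {0..T}" for s
  proof -
    define x y z where "x = norm (ip u0 (\<phi> j))" and "y = T * norm ?c" and "z = norm (f_tilde ip (\<phi> j) f s)"
    have "norm (coef_data j s) \<le> x + norm (s *\<^sub>R ?c) + z"
      unfolding coef_data_def x_def z_def by (intro norm_triangle_mono norm_triangle_ineq order_refl)
    also have "norm (s *\<^sub>R ?c) \<le> y"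
      using s by (simp add: y_def mult_right_mono)
    finally have "(norm (coef_data j s))\<^sup>2 \<le> (x + y + z)\<^sup>2"
      by (intro power_mono) auto
    \<comment> \<open>The difference of the two sides is the sum of the squares of
      \<open>x - y\<close>, \<open>y - z\<close> and \<open>x - z\<close>.\<close>
    also have "\<dots> \<le> 3 * (x\<^sup>2 + y\<^sup>2 + z\<^sup>2)"
      using sum_squares_ge_zero[of "x - y" "y - z"] zero_le_square[of "x - z"]
      by (simp add: power2_eq_square algebra_simps)
    also have "\<dots> \<le> 3 * ?L"
      using L_coef_ge[OF s, of j] by (simp add: x_def y_def z_def power_mult_distrib)
    finally show ?thesis
      by (rule real_le_rsqrt)
  qed
  have L: "0 \<le> ?L" using order_trans[OF norm_ge_zero w[OF t]] by simp
  have "norm (coef j t) \<le> sqrt (3 * ?L) * exp (lam j * M_const T h * T)"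
    unfolding coef_def
    by (rule resolvent_norm_bound[OF h h_nonneg less_imp_le[OF lam_pos] t continuous_coef_data w])
  then have "(norm (coef j t))\<^sup>2 \<le> (sqrt (3 * ?L) * exp (lam j * M_const T h * T))\<^sup>2"
    by (intro power_mono) auto
  also have "\<dots> = 3 * (?L * exp (2 * lam j * M_const T h * T))"
    using L by (simp add: power_mult_distrib algebra_simps flip: exp_double)
  finally show ?thesis .
qed

section \<open>Uniqueness and existence\<close>

lemma solution_unique:
  assumes "is_solution T D A h f u0 u2 u" "is_solution T D A h f u0 u2 v" "t \<in> {0..T}"
  shows "u t = v t"
  by (rule orthonormal_basis_eqI[OF \<phi>])
    (simp only: ip_solution[OF assms(1,3)] ip_solution[OF assms(2,3)])

lemma solution_exists:
  assumes lam: "mono lam"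
    and sum: "summable (\<lambda>j. L_coef ip T h f u0 u2 (lam j) (\<phi> j) * lam j ^ 3
                        * exp (2 * lam j * M_const T h * T))"
  shows "\<exists>u. is_solution T D A h f u0 u2 u"
proof -
  let ?c = "\<lambda>j. c_coef ip T h f u0 u2 (lam j) (\<phi> j)"
  define L where "L = (\<lambda>j. L_coef ip T h f u0 u2 (lam j) (\<phi> j))"
  define e where "e = (\<lambda>j. exp (2 * lam j * M_const T h * T))"
  define B where "B = (\<lambda>j. L j * lam j ^ 3 * e j)"
  have B: "summable B" using sum by (simp add: B_def L_def e_def)
  have lam0: "lam 0 \<le> lam j" for j using lam by (simp add: monoD)
  have T0: "0 \<in> {0..T}" "T \<in> {0..T}" using T by auto
  have M: "0 \<le> M_const T h" using abs_int2_le_M_const[OF h T0(1)] by linarith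
  have e: "1 \<le> e j" for j using M T less_imp_le[OF lam_pos[of j]] by (simp add: e_def)
  have Lc: "T\<^sup>2 * (norm (?c j))\<^sup>2 \<le> L j" for j
    using L_coef_ge[OF T0(1), of j] by (simp add: L_def) (smt (verit) zero_le_power2)
  have L: "0 \<le> L j" for j using Lc[of j] by (rule order_trans[rotated]) simp
  \<comment> \<open>Since \<open>lam j \<ge> lam 0 > 0\<close>, surplus powers of
    \<open>lam j\<close> in \<open>B j\<close> are bounded below by powers of \<open>lam 0\<close>:
    three for the series of \<open>u\<close>, one for that of \<open>A u\<close>, whose squared
    coefficients carry \<open>(lam j)\<^sup>2\<close>.\<close>
  have Le: "L j * e j \<le> B j / lam 0 ^ 3" "(lam j)\<^sup>2 * (L j * e j) \<le> B j / lam 0" for j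
  proof -
    have E: "0 \<le> L j * e j" using L[of j] e[of j] by simp
    have "L j * e j * lam 0 ^ 3 \<le> L j * e j * lam j ^ 3"
      using lam0[of j] lam_pos[of 0] by (intro mult_left_mono power_mono E) auto
    then show "L j * e j \<le> B j / lam 0 ^ 3"
      using lam_pos[of 0] by (simp add: pos_le_divide_eq B_def algebra_simps)
    have "((lam j)\<^sup>2 * (L j * e j)) * lam 0 \<le> ((lam j)\<^sup>2 * (L j * e j)) * lam j"
      by (intro mult_left_mono lam0 mult_nonneg_nonneg E) auto
    then show "(lam j)\<^sup>2 * (L j * e j) \<le> B j / lam 0"
      using lam_pos[of 0] by (simp add: pos_le_divide_eq B_def algebra_simps power2_eq_square power3_eq_cube)
  qed
  have coef: "(norm (coef j t))\<^sup>2 \<le> 3 * (L j * e j)" if "t \<in> {0..T}" for j t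
    using norm_coef_le[OF that, of j] by (simp add: L_def e_def)

  obtain u where ul: "uniform_limit {0..T} (\<lambda>n t. \<Sum>j<n. smul (coef j t) (\<phi> j)) u sequentially"
    and u: "\<And>j t. t \<in> {0..T} \<Longrightarrow> ip (u t) (\<phi> j) = coef j t"
  proof (rule uniform_orthonormal_series[OF \<phi>])
    show "(norm (coef j t))\<^sup>2 \<le> 3 * (B j / lam 0 ^ 3)" if "t \<in> {0..T}" for j t
      using coef[OF that, of j] Le(1)[of j] by linarith
    show "summable (\<lambda>j. 3 * (B j / lam 0 ^ 3))"
      by (intro summable_mult summable_divide B)
  qed blast
  obtain a where al: "uniform_limit {0..T} (\<lambda>n t. \<Sum>j<n. smul (lam j *\<^sub>R coef j t) (\<phi> j)) a sequentially"
    and a: "\<And>j t. t \<in> {0..T} \<Longrightarrow> ip (a t) (\<phi> j) = lam j *\<^sub>R coef j t"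
  proof (rule uniform_orthonormal_series[OF \<phi>])
    show "(norm (lam j *\<^sub>R coef j t))\<^sup>2 \<le> 3 * (B j / lam 0)" if "t \<in> {0..T}" for j t
    proof -
      have "(norm (lam j *\<^sub>R coef j t))\<^sup>2 \<le> (lam j)\<^sup>2 * (3 * (L j * e j))"
        using coef[OF that, of j] by (simp add: power_mult_distrib mult_left_mono)
      then show ?thesis using Le(2)[of j] by linarith
    qed
    show "summable (\<lambda>j. 3 * (B j / lam 0))"
      by (intro summable_mult summable_divide B)
  qed blast
  \<comment> \<open>The initial slope is a series without parameter, so the index set is the
    one-point type. The majorant comes from
    \<open>T\<^sup>2 * (norm (?c j))\<^sup>2 \<le> L j\<close> and \<open>1 \<le> e j\<close>, after
    division by \<open>T\<^sup>2\<close>.\<close>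
  obtain c where c: "\<And>j. ip c (\<phi> j) = ?c j"
  proof (rule uniform_orthonormal_series[OF \<phi>, where S = UNIV and a = "\<lambda>j t::unit. ?c j"])
    show "(norm (?c j))\<^sup>2 \<le> B j / lam 0 ^ 3 / T\<^sup>2" for j
    proof -
      have "T\<^sup>2 * (norm (?c j))\<^sup>2 \<le> L j * e j"
        using Lc[of j] mult_left_mono[OF e L, of j j] by simp
      with Le(1)[of j] have "(norm (?c j))\<^sup>2 * T\<^sup>2 \<le> B j / lam 0 ^ 3"
        by (simp only: mult.commute[of _ "T\<^sup>2"])
      then show ?thesis
        using T by (subst pos_le_divide_eq) simp_all
    qed
    show "summable (\<lambda>j. B j / lam 0 ^ 3 / T\<^sup>2)"
      by (intro summable_divide B)
  qed blast

  have lin: "linear_operator smul D A" using A by (simp add: selfadjoint_def)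
  \<comment> \<open>The partial sums lie in \<open>D\<close> and their images under \<open>A\<close>
    are the partial sums for \<open>a\<close>; closedness of \<open>A\<close> carries this to the
    limit.\<close>
  have Au: "u t \<in> D \<and> A (u t) = a t" if t: "t \<in> {0..T}" for t
    using selfadjoint_closed[OF A eigenvector_sum(1)[OF lin \<phi>_mem A_\<phi>]
        tendsto_uniform_limitI[OF ul t]] tendsto_uniform_limitI[OF al t]
    by (simp add: eigenvector_sum(2)[OF lin \<phi>_mem A_\<phi>])
  have smul_cont: "continuous_on {0..T} (\<lambda>t. smul (g t) x)" if "continuous_on {0..T} g" for g x
  proof (rule bounded_linear.continuous_on[OF _ that])
    show "bounded_linear (\<lambda>c. smul c x)"
      by (rule bounded_linear_intro[where K="norm x"])
        (simp_all add: scale_left_distrib norm_smul scaleR_conv_of_real flip: scale_of_real)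
  qed
  have ca: "continuous_on {0..T} a"
    by (rule uniform_limit_theorem[OF _ al])
      (auto intro!: always_eventually continuous_on_sum smul_cont continuous_intros continuous_coef)
  define g where "g = (\<lambda>t. conv h a t + f t)"
  have g: "continuous_on {0..T} g"
    unfolding g_def by (intro continuous_intros continuous_conv h ca f)
  \<comment> \<open>\<open>U\<close> is the twice integrated right-hand side with \<open>a\<close>
    in place of \<open>A u\<close>. Its coefficients satisfy the equation of
    \<open>coef_volterra\<close>, so it agrees with \<open>u\<close> on \<open>{0..T}\<close>, while
    its derivatives are explicit.\<close>
  define U where "U = (\<lambda>t. u0 + t *\<^sub>R c + int2 g t)"
  have U: "U t = u t" if t: "t \<in> {0..T}" for t
  proof (rule orthonormal_basis_eqI[OF \<phi>])
    fix j
    have "ip (U t) (\<phi> j) = coef_data j t + lam j *\<^sub>R conv (int2 h) (coef j) t"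
      unfolding U_def g_def coef_data_def
      by (subst ip_int2_conv[OF h ca f continuous_coef a t]) (simp_all add: c)
    then show "ip (U t) (\<phi> j) = ip (u t) (\<phi> j)"
      by (simp add: coef_volterra[OF t, symmetric] u[OF t])
  qed
  have C2: "C2_on_with {0..T} U (\<lambda>t. c + integral {0..t} g) g"
    unfolding U_def by (rule C2_on_with_int2[OF g])
  have AU: "U t \<in> D" "A (U t) = a t" if "t \<in> {0..T}" for t
    using Au[OF that] U[OF that] by simp_all
  have "U T = u2"
    by (rule orthonormal_basis_eqI[OF \<phi>]) (simp only: U[OF T0(2)] u[OF T0(2)] coef_T)
  moreover have "U 0 = u0" by (simp add: U_def conv_def)
  moreover have "continuous_on {0..T} U"
    using C2 unfolding C2_on_with_def
    by (meson continuous_on_vector_derivative)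
  then have "continuous_graph_norm {0..T} D A U"
    using ca AU by (simp add: continuous_graph_norm_iff[OF lin] cong: continuous_on_cong_simp)
  moreover have "g t = conv h (\<lambda>s. A (U s)) t + f t" if "t \<in> {0..T}" for t
    using conv_cong[of t h h a "\<lambda>s. A (U s)"] AU(2) that by (simp add: g_def)
  ultimately have "is_solution T D A h f u0 u2 U"
    unfolding is_solution_def using C2 by blast
  then show ?thesis by (rule exI[of _ U])
qed

end

theorem theorem4p1:
  fixes smul :: "'k::{real_normed_field,euclidean_space} \<Rightarrow> 'h::banach \<Rightarrow> 'h"
    and ip :: "'h \<Rightarrow> 'h \<Rightarrow> 'k"
    and D :: "'h set" and A :: "'h \<Rightarrow> 'h"
    and \<phi> :: "nat \<Rightarrow> 'h" and lam :: "nat \<Rightarrow> real"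
    and T :: real and h :: "real \<Rightarrow> real" and f :: "real \<Rightarrow> 'h" and u0 u2 :: 'h
  assumes "hilbert_space smul ip"
    and "selfadjoint smul ip D A"
    and "orthonormal_basis smul ip \<phi>"
    and "\<And>j. \<phi> j \<in> D" and "\<And>j. A (\<phi> j) = lam j *\<^sub>R \<phi> j"
    and "mono lam" and "\<And>j. lam j > 0" and "filterlim lam at_top sequentially"
    and "T > 0"
    and "C1_on {0..T} f"
    and "u0 \<in> D"
    and "continuous_on {0..T} h" and "\<And>t. t \<in> {0..T} \<Longrightarrow> h t \<ge> 0"
    and "summable (\<lambda>j. L_coef ip T h f u0 u2 (lam j) (\<phi> j) * lam j ^ 3
                        * exp (2 * lam j * M_const T h * T))"
  shows "(\<exists>u. is_solution T D A h f u0 u2 u) \<and>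
         (\<forall>u v. is_solution T D A h f u0 u2 u \<longrightarrow> is_solution T D A h f u0 u2 v \<longrightarrow>
            (\<forall>t\<in>{0..T}. u t = v t))"
proof -
  have f: "continuous_on {0..T} f"
    using assms(10) unfolding C1_on_def by (blast intro: continuous_on_vector_derivative)
  interpret hilbert_space smul ip by fact
  interpret volterra_problem smul ip D A \<phi> lam T h f u0 u2
    by unfold_locales (use assms f in auto)
  show ?thesis
    using solution_exists[OF assms(6,14)] solution_unique by blast
qed

end
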